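(* Fix a constant integer $r\ge 2$. If $P$ is an $r$-partite $r$-pattern, then for any integer $m$ with $2\le m\le n^{1/r}$ we have \[N_{P,m}(n)= e^{O_r(n)}\,(m-1)^{(r/(r-1))n}\, n^{(r-1-1/(r-1))n},\] where the constant implicit in $O_r(n)$ depends only on $r$ (in particular not on $m$).
   Context: An (ordered) $r$-matching is an $r$-uniform hypergraph on a totally ordered vertex set in which every vertex is contained in exactly one edge; its size is its number of edges. An $r$-matching is $r$-partite if, when the vertex set is divided into $r$ contiguous intervals of equal length, every edge has exactly one vertex in each interval. An $r$-pattern is an $r$-matching of size $2$ on the vertex set $\{1,\dots,2r\}$. An $r$-matching is a $P$-clique if every pair of its edges (with the induced ordering on their $2r$ vertices) is order-isomorphic to $P$; $L_P(M)$ is the size of the largest $P$-clique formed by a subset of the edges of $M$. $N_{P,m}(n)$ denotes the number of $r$-matchings $M$ on the vertex set $\{1,\dots,rn\}$ with $L_P(M)<m$. Asymptotics are as $n\to\infty$; $f=e^{O_r(n)}g$ means that there is a constant $C$ depending only on $r$ such that $e^{-Cn}g\le f\le e^{Cn}g$ for all sufficiently large $n$. *)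

theory Defs
  imports Complex_Main
begin

text \<open>A matching is represented by its set of edges. Since all edges of a matching are nonempty
  whenever \<open>r \<ge> 1\<close>, the vertex set is recovered as the union of the edges.\<close>

definition r_matching :: "nat \<Rightarrow> 'a::linorder set \<Rightarrow> 'a set set \<Rightarrow> bool" where
  "r_matching r V M \<longleftrightarrow>
     finite V \<and> (\<forall>e\<in>M. e \<subseteq> V \<and> card e = r) \<and> (\<forall>v\<in>V. \<exists>!e. e \<in> M \<and> v \<in> e)"

text \<open>Here \<open>M\<close> is a matching of size \<open>k\<close> on the vertex set \<open>{1..r * k}\<close>, whose division into \<open>r\<close>
  contiguous intervals of equal length consists of the intervals \<open>{i * k + 1..(i + 1) * k}\<close>.\<close>

definition r_partite :: "nat \<Rightarrow> nat \<Rightarrow> nat set set \<Rightarrow> bool" where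
  "r_partite r k M \<longleftrightarrow> (\<forall>e\<in>M. \<forall>i<r. card (e \<inter> {i * k + 1..(i + 1) * k}) = 1)"

definition r_pattern :: "nat \<Rightarrow> nat set set \<Rightarrow> bool" where
  "r_pattern r P \<longleftrightarrow> r_matching r {1..2 * r} P \<and> card P = 2"

text \<open>A strictly monotone map is injective, and mapping the edges of \<open>M\<close> onto those of \<open>M'\<close> it is a
  bijection between the vertex sets.\<close>

definition order_isomorphic :: "'a::linorder set set \<Rightarrow> 'b::linorder set set \<Rightarrow> bool" where
  "order_isomorphic M M' \<longleftrightarrow> (\<exists>f. strict_mono_on (\<Union>M) f \<and> (\<lambda>e. f ` e) ` M = M')"

definition is_clique :: "nat set set \<Rightarrow> 'a::linorder set set \<Rightarrow> bool" where
  "is_clique P K \<longleftrightarrow> (\<forall>e\<in>K. \<forall>e'\<in>K. e \<noteq> e' \<longrightarrow> order_isomorphic {e, e'} P)"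

definition max_clique_size :: "nat set set \<Rightarrow> 'a::linorder set set \<Rightarrow> nat" where
  "max_clique_size P M = Max {card K |K. K \<subseteq> M \<and> is_clique P K}"

definition num_matchings :: "nat \<Rightarrow> nat set set \<Rightarrow> nat \<Rightarrow> nat \<Rightarrow> nat" where
  "num_matchings r P m n =
     card {M :: nat set set. r_matching r {1..r * n} M \<and> max_clique_size P M < m}"

end

theory Submission
  imports Defs "HOL-Library.FuncSet" "HOL-Combinatorics.Permutations"
begin

text \<open>
  Write \<open>k = m - 1\<close> and \<open>Q = (n / k)\<close> to the power \<open>1 / (r - 1)\<close>; the claimed order of magnitude is then
  \<open>(n / Q) ^ (r * n)\<close> (lemma \<open>growth_rate_eq\<close>). An edge is a point of an \<open>r\<close>-dimensional grid, an
  \<open>r\<close>-partite pattern is a vector of signs, and a clique is a sequence of points that moves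
  monotonically in every coordinate, in the direction given by the sign. Both bounds come from
  cutting each axis into about \<open>Q\<close> intervals: about \<open>k * Q ^ (r - 1) = n\<close> cells are
  occupied, and once the cells are known every vertex is free to move over \<open>n / Q\<close> positions.

  For the lower bound (\<open>num_matchings_lower\<close>), take \<open>n\<close> cells whose coordinate sums take only \<open>k\<close> values
  and place one edge into each, the order inside each slab being arbitrary. Along a clique the
  coordinate sum strictly increases (after reversing the coordinates with negative sign), so no
  clique exceeds \<open>k\<close>.

  For the upper bound (\<open>num_matchings_upper\<close>), the number of occupied cells in a grid with \<open>K\<close>
  intervals is at most a constant times \<open>k * K ^ (r - 1)\<close> (\<open>card_cells_le\<close>). Refining the grid
  dyadically, the occupied cells at one scale leave at most \<open>2 ^ r\<close> candidates each at
  the next; the costs form a geometric series, so only \<open>e ^ O(n)\<close> families of \<open>O(n)\<close> cells occur at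
  the final scale. Given the family, the matching is an \<open>n\<close>-element subset of a set of
  \<open>O(n) * O(n / Q) ^ r\<close> possible edges, which leaves \<open>e ^ O(n) * (n / Q) ^ (r * n)\<close> choices.

  The heart is the density bound for cells. An arbitrary matching need not be \<open>r\<close>-partite, and a
  monotone chain of cells yields a clique only if all its \<open>i\<close>-th coordinates lie below all its
  \<open>(i+1)\<close>-st coordinates; covering the cells by diagonals would lose a logarithm. Instead, the
  grid is sliced into planes in which the separation conditions become one condition on a
  rectangle, and each plane is handled by a form of the Capoyleas-Pach theorem on ordered graphs without
  \<open>k + 1\<close> pairwise crossing edges (\<open>triangle_density\<close>). Its proof here counts: fillings of the edge set
  by weights up to \<open>w\<close> are determined, through the local rules of the Robinson-Schensted-Knuth
  correspondence, by at most \<open>k\<close> numbers of size \<open>O(w)\<close> at each point of the boundary of the triangle; comparing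
  exponents of \<open>w\<close> bounds the number of edges.
\<close>

section \<open>Last passage times and shadows\<close>

text \<open>The maximal weight of a lattice path through the cells \<open>[0, i) \<times> [0, j)\<close> that is weakly
  increasing in both coordinates: the first part of the partition that the
  Robinson-Schensted-Knuth correspondence assigns to this rectangle.\<close>

fun last_passage :: "(nat \<Rightarrow> nat \<Rightarrow> nat) \<Rightarrow> nat \<Rightarrow> nat \<Rightarrow> nat" where
  "last_passage x 0 j = 0"
| "last_passage x (Suc i) 0 = 0"
| "last_passage x (Suc i) (Suc j) = max (last_passage x i (Suc j)) (last_passage x (Suc i) j) + x i j"

text \<open>Viennot's shadow: a new filling whose last passage times are the second part of the partition.
  Iterating gives all the parts.\<close>

definition shadow :: "(nat \<Rightarrow> nat \<Rightarrow> nat) \<Rightarrow> nat \<Rightarrow> nat \<Rightarrow> nat" where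
  "shadow x i j = min (last_passage x i (Suc j)) (last_passage x (Suc i) j) - last_passage x i j"

definition has_antichain :: "(nat \<Rightarrow> nat \<Rightarrow> nat) \<Rightarrow> nat \<Rightarrow> nat \<Rightarrow> nat \<Rightarrow> bool" where
  "has_antichain x k i j \<longleftrightarrow> (\<exists>a b. (\<forall>t<k. a t < i \<and> b t < j \<and> 0 < x (a t) (b t)) \<and>
     (\<forall>t. Suc t < k \<longrightarrow> a t < a (Suc t) \<and> b (Suc t) < b t))"

lemma last_passage_Suc1: "last_passage x i j \<le> last_passage x (Suc i) j"
  by (cases i; cases j) auto

lemma last_passage_Suc2: "last_passage x i j \<le> last_passage x i (Suc j)"
  by (cases i) auto

lemma last_passage_mono:
  assumes "i \<le> i'" "j \<le> j'"
  shows "last_passage x i j \<le> last_passage x i' j'"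
proof -
  have "last_passage x i j \<le> last_passage x i' j"
    using assms(1) by (rule lift_Suc_mono_le[of "\<lambda>i. last_passage x i j", rotated])
      (rule last_passage_Suc1)
  also have "\<dots> \<le> last_passage x i' j'"
    using assms(2) by (rule lift_Suc_mono_le[rotated]) (rule last_passage_Suc2)
  finally show ?thesis .
qed

lemma last_passage_pos:
  assumes "0 < last_passage x i j"
  shows "\<exists>a<i. \<exists>b<j. 0 < x a b"
  using assms
proof (induction x i j rule: last_passage.induct)
  case (3 x i j)
  then consider "0 < last_passage x i (Suc j)" | "0 < last_passage x (Suc i) j" | "0 < x i j"
    by fastforce
  then show ?case
  proof cases
    case 1
    then show ?thesis using 3(1) less_SucI by blast
  next
    case 2
    then show ?thesis using 3(2) less_SucI by blast
  qed blast
qed auto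

text \<open>The cells that reach the level \<open>t\<close> form an up-set whose minimal cells are occupied. Descending
  in a column from the level \<open>t\<close> one meets such a minimal cell, provided that the column before it
  stays below \<open>t\<close>.\<close>

lemma entry_above:
  assumes "last_passage x i b < t" "t \<le> last_passage x i (Suc b)"
  shows "\<exists>a<i. 0 < x a b \<and> t \<le> last_passage x (Suc a) (Suc b)"
  using assms
proof (induction i)
  case (Suc i)
  show ?case
  proof (cases "t \<le> last_passage x i (Suc b)")
    case True
    moreover have "last_passage x i b < t"
      using Suc.prems(1) last_passage_Suc1[of x i b] by linarith
    ultimately show ?thesis using Suc.IH less_SucI by blast
  next
    case False
    then have "0 < x i b" using Suc.prems by auto
    then show ?thesis using Suc.prems by blast
  qed
qed auto

lemma entry_left:
  assumes "last_passage x a j < t" "t \<le> last_passage x (Suc a) j"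
  shows "\<exists>b<j. 0 < x a b \<and> t \<le> last_passage x (Suc a) (Suc b)"
  using assms
proof (induction j)
  case (Suc j)
  show ?case
  proof (cases "t \<le> last_passage x (Suc a) j")
    case True
    moreover have "last_passage x a j < t"
      using Suc.prems(1) last_passage_Suc2[of x a j] by linarith
    ultimately show ?thesis using Suc.IH less_SucI by blast
  next
    case False
    then have "0 < x a j" using Suc.prems by auto
    then show ?thesis using Suc.prems by blast
  qed
qed auto

text \<open>A shadow cell \<open>(a, b)\<close> is an inner corner of the region above the level \<open>last_passage x a b + 1\<close>,
  so it has an occupied outer corner to its left in its row and one above it in its column. If
  neither the left corner of the first shadow cell nor the upper corner of the second lay in the
  box between them, then the level at each of the two cells would exceed the level at the other.\<close>

lemma entry_between_shadows:
  assumes "0 < shadow x a b" "0 < shadow x a' b'" "a < a'" "b' < b"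
  shows "\<exists>i j. 0 < x i j \<and> a \<le> i \<and> i < a' \<and> b' \<le> j \<and> j < b"
proof -
  obtain j where j: "j < b" "0 < x a j" "last_passage x a b < last_passage x (Suc a) (Suc j)"
    using entry_left[of x a b "Suc (last_passage x a b)"] assms(1)
    unfolding shadow_def by (auto simp: Suc_le_eq)
  obtain i where i: "i < a'" "0 < x i b'" "last_passage x a' b' < last_passage x (Suc i) (Suc b')"
    using entry_above[of x a' b' "Suc (last_passage x a' b')"] assms(2)
    unfolding shadow_def by (auto simp: Suc_le_eq)
  have "b' \<le> j \<or> a \<le> i"
  proof (rule ccontr)
    assume "\<not> ?thesis"
    then have "last_passage x (Suc a) (Suc j) \<le> last_passage x a' b'"
      "last_passage x (Suc i) (Suc b') \<le> last_passage x a b"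
      using assms by (auto intro!: last_passage_mono simp del: last_passage.simps)
    with i(3) j(3) show False by linarith
  qed
  then show ?thesis using i j assms by (elim disjE) (force, force)
qed

text \<open>An antichain of \<open>k\<close> shadows separates \<open>k + 1\<close> boxes, each of which contains an occupied cell:
  the boxes between consecutive shadows by the previous lemma, and the two outer boxes by the corners
  of the first and the last shadow.\<close>

lemma has_antichain_shadow:
  assumes "has_antichain (shadow x) (Suc k) i j"
  shows "has_antichain x (Suc (Suc k)) i j"
proof -
  obtain a b where ab: "\<And>t. t < Suc k \<Longrightarrow> a t < i \<and> b t < j \<and> 0 < shadow x (a t) (b t)"
    and chain: "\<And>t. Suc t < Suc k \<Longrightarrow> a t < a (Suc t) \<and> b (Suc t) < b t"
    using assms unfolding has_antichain_def by blast
  have "\<exists>r c. 0 < x r c \<and> r < i \<and> c < j \<and> (\<forall>u. t = Suc u \<longrightarrow> a u \<le> r \<and> c < b u)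
      \<and> (t \<le> k \<longrightarrow> r < a t \<and> b t \<le> c)" if t: "t < Suc (Suc k)" for t
  proof (cases t)
    case 0
    obtain r where "r < a 0" "0 < x r (b 0)"
      using entry_above[of x "a 0" "b 0" "Suc (last_passage x (a 0) (b 0))"] ab[of 0]
      unfolding shadow_def by (auto simp: Suc_le_eq)
    with 0 ab[of 0] show ?thesis by (intro exI[of _ r] exI[of _ "b 0"]) auto
  next
    case (Suc u)
    show ?thesis
    proof (cases "t \<le> k")
      case True
      then obtain r c where "0 < x r c" "a u \<le> r" "r < a t" "b t \<le> c" "c < b u"
        using entry_between_shadows[of x "a u" "b u" "a t" "b t"] ab[of u] ab[of t] chain[of u] Suc
        by auto
      with ab[of t] ab[of u] Suc True show ?thesis
        by (intro exI[of _ r] exI[of _ c]) auto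
    next
      case False
      then have u: "u = k" using Suc t by simp
      obtain c where "c < b k" "0 < x (a k) c"
        using entry_left[of x "a k" "b k" "Suc (last_passage x (a k) (b k))"] ab[of k]
        unfolding shadow_def by (auto simp: Suc_le_eq)
      with Suc False u ab[of k] show ?thesis by (intro exI[of _ "a k"] exI[of _ c]) auto
    qed
  qed
  then obtain r c where rc: "\<And>t. t < Suc (Suc k) \<Longrightarrow> 0 < x (r t) (c t) \<and> r t < i \<and> c t < j
      \<and> (\<forall>u. t = Suc u \<longrightarrow> a u \<le> r t \<and> c t < b u) \<and> (t \<le> k \<longrightarrow> r t < a t \<and> b t \<le> c t)"
    by metis
  have "r t < r (Suc t) \<and> c (Suc t) < c t" if "Suc t < Suc (Suc k)" for t
    using rc[of t] rc[of "Suc t"] that by force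
  with rc show ?thesis unfolding has_antichain_def by blast
qed

text \<open>This is the part of Greene's theorem needed here: the number of nonzero parts of the partition of
  a rectangle is at most the length of its longest antichain.\<close>

lemma has_antichain_iterated_shadow:
  assumes "0 < last_passage ((shadow ^^ s) x) i j"
  shows "has_antichain x (Suc s) i j"
proof -
  have "has_antichain ((shadow ^^ s) x) (Suc 0) i j"
  proof -
    obtain a b where "a < i" "b < j" "0 < (shadow ^^ s) x a b"
      using last_passage_pos[OF assms] by blast
    then show ?thesis unfolding has_antichain_def
      by (intro exI[of _ "\<lambda>_. a"] exI[of _ "\<lambda>_. b"]) simp
  qed
  then show ?thesis
  proof (induction s arbitrary: x)
    case (Suc s)
    have "has_antichain (shadow x) (Suc s) i j"
      using Suc.prems by (intro Suc.IH) (simp only: funpow_Suc_right comp_apply)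
    then show ?case by (rule has_antichain_shadow)
  qed simp
qed

text \<open>This and the next equation invert the growth rule: the values at three corners of
  a unit square, for all parts, determine the value at the fourth corner and the entry of the
  square.\<close>

lemma last_passage_eq_shadow:
  "last_passage x i j =
     min (last_passage x i (Suc j)) (last_passage x (Suc i) j) - shadow x i j"
  using last_passage_Suc1[of x i j] last_passage_Suc2[of x i j] unfolding shadow_def by auto

lemma entry_eq_last_passage:
  "x i j = last_passage x (Suc i) (Suc j) -
     max (last_passage x i (Suc j)) (last_passage x (Suc i) j)"
  by simp

text \<open>Two neighbouring antidiagonals determine everything below them, one antidiagonal at a time.\<close>

lemma last_passage_determined:
  assumes "\<And>s i j. i + j = L \<or> i + j = Suc L \<Longrightarrow>
    last_passage ((shadow ^^ s) x) i j = last_passage ((shadow ^^ s) y) i j"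
  shows "i + j \<le> Suc L \<Longrightarrow> last_passage ((shadow ^^ s) x) i j = last_passage ((shadow ^^ s) y) i j"
proof (induction "Suc L - (i + j)" arbitrary: i j s rule: less_induct)
  case less
  show ?case
  proof (cases "i + j \<ge> L")
    case True
    then have "i + j = L \<or> i + j = Suc L" using less.prems by linarith
    then show ?thesis by (rule assms)
  next
    case False
    have IH: "last_passage ((shadow ^^ s) x) i' j' = last_passage ((shadow ^^ s) y) i' j'"
      if "i' + j' > i + j" "i' + j' \<le> Suc L" for i' j' s
      using less.hyps[of i' j' s] that by linarith
    have "(shadow ^^ Suc s) x i j = (shadow ^^ Suc s) y i j"
      unfolding entry_eq_last_passage[of "(shadow ^^ Suc s) x" i j]
        entry_eq_last_passage[of "(shadow ^^ Suc s) y" i j]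
      using False IH[of "Suc i" "Suc j" "Suc s"] IH[of i "Suc j" "Suc s"] IH[of "Suc i" j "Suc s"]
      by (simp del: last_passage.simps funpow.simps)
    then have "shadow ((shadow ^^ s) x) i j = shadow ((shadow ^^ s) y) i j" by simp
    then show ?thesis
      unfolding last_passage_eq_shadow[of "(shadow ^^ s) x" i j]
        last_passage_eq_shadow[of "(shadow ^^ s) y" i j]
      using False IH[of i "Suc j" s] IH[of "Suc i" j s] by (simp del: last_passage.simps)
  qed
qed

lemma filling_determined:
  assumes "\<And>s i j. i + j = L \<or> i + j = Suc L \<Longrightarrow>
    last_passage ((shadow ^^ s) x) i j = last_passage ((shadow ^^ s) y) i j"
    and "i + j < L"
  shows "x i j = y i j"
proof -
  have "last_passage x i' j' = last_passage y i' j'" if "i' + j' \<le> Suc L" for i' j'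
    using last_passage_determined[OF assms(1) that, of 0] by simp
  then show ?thesis
    unfolding entry_eq_last_passage[of x i j] entry_eq_last_passage[of y i j]
    using assms(2) by (simp del: last_passage.simps)
qed

lemma last_passage_bound:
  assumes "\<And>i j. i + j < L \<Longrightarrow> x i j \<le> w" "i + j \<le> Suc L"
  shows "last_passage x i j \<le> (i + j) * w"
  using assms
proof (induction x i j rule: last_passage.induct)
  case (3 x i j)
  have "last_passage x i (Suc j) \<le> (Suc (i + j)) * w" "last_passage x (Suc i) j \<le> (Suc (i + j)) * w"
    using 3 by auto
  moreover have "x i j \<le> w" using 3(3)[of i j] 3(4) by simp
  ultimately show ?case by simp
qed auto

lemma iterated_shadow_bound:
  assumes "\<And>i j. i + j < L \<Longrightarrow> x i j \<le> w" "i + j < L"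
  shows "(shadow ^^ s) x i j \<le> L ^ s * w"
  using assms(2)
proof (induction s arbitrary: i j)
  case (Suc s)
  have "(shadow ^^ Suc s) x i j \<le> last_passage ((shadow ^^ s) x) i (Suc j)"
    by (simp add: shadow_def)
  also have "\<dots> \<le> (i + Suc j) * (L ^ s * w)"
    using Suc by (intro last_passage_bound[of L]) auto
  also have "\<dots> \<le> L * (L ^ s * w)" using Suc.prems by (intro mult_right_mono) auto
  finally show ?case by simp
qed (use assms in auto)

lemma iterated_last_passage_bound:
  assumes "\<And>i j. i + j < L \<Longrightarrow> x i j \<le> w" "i + j \<le> Suc L"
  shows "last_passage ((shadow ^^ s) x) i j \<le> Suc L ^ Suc s * w"
proof -
  have "last_passage ((shadow ^^ s) x) i j \<le> (i + j) * (L ^ s * w)"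
    using iterated_shadow_bound[OF assms(1)] assms(2) by (intro last_passage_bound[of L]) auto
  also have "\<dots> \<le> Suc L * (Suc L ^ s * w)"
    using assms(2) by (intro mult_mono power_mono) auto
  finally show ?thesis by (simp add: algebra_simps)
qed

section \<open>Density of a triangle without long antichains\<close>

text \<open>With \<open>j\<close> counted from the far end of the vertex set, the cells \<open>i + j < L\<close> are the pairs of vertices
  in increasing order, and the forbidden antichains, whose bounding rectangle lies in the triangle, are the sets of \<open>k + 1\<close>
  pairwise crossing edges. There are \<open>(w + 1) ^ card B\<close> fillings of \<open>B\<close> by numbers up to \<open>w\<close>.
  Each is determined by its last passage data on the two outer antidiagonals, where only the first
  \<open>k\<close> parts can be nonzero; this data has \<open>k * (2 * L + 3)\<close> entries of size \<open>O(w)\<close>. For large \<open>w\<close>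
  this forces \<open>card B \<le> k * (2 * L + 3)\<close>.\<close>

lemma triangle_density:
  assumes "\<And>i j. (i, j) \<in> B \<Longrightarrow> i + j < L"
    and no: "\<nexists>a b. (\<forall>t<Suc k. (a t, b t) \<in> B) \<and> (\<forall>t. Suc t < Suc k \<longrightarrow> a t < a (Suc t) \<and> b (Suc t) < b t)
          \<and> (\<forall>t<Suc k. \<forall>u<Suc k. a t + b u < L)"
  shows "card B \<le> k * (2 * L + 3)"
proof (rule ccontr)
  assume large: "\<not> ?thesis"
  have finB: "finite B"
  proof (rule finite_subset)
    show "B \<subseteq> {..<L} \<times> {..<L}" using assms(1) by fastforce
  qed simp
  define E where "E = {(i, j). i + j = L \<or> i + j = Suc L}"
  have E: "E = (\<lambda>i. (i, L - i)) ` {..L} \<union> (\<lambda>i. (i, Suc L - i)) ` {..Suc L}"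
    unfolding E_def by (auto simp: image_iff)
  have finE: "finite E" unfolding E by simp
  have cardE: "card E \<le> 2 * L + 3"
  proof -
    have "card E \<le> card ((\<lambda>i. (i, L - i)) ` {..L}) + card ((\<lambda>i. (i, Suc L - i)) ` {..Suc L})"
      unfolding E by (rule card_Un_le)
    also have "\<dots> \<le> card {..L} + card {..Suc L}"
      by (intro add_mono card_image_le) auto
    finally show ?thesis by simp
  qed
  define D where "D = {..<k} \<times> E"
  have finD: "finite D" unfolding D_def using finE by simp
  have cardD: "card D < card B"
  proof -
    have "card D \<le> k * (2 * L + 3)" unfolding D_def using cardE by (simp add: card_cartesian_product)
    then show ?thesis using large by linarith
  qed
  define c where "c = Suc L ^ Suc k"
  \<comment> \<open>Large enough for the final comparison \<open>(c * Suc w) ^ card D < Suc w ^ Suc (card D)\<close>.\<close>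
  define w where "w = c ^ card D"
  define F where "F = B \<rightarrow>\<^sub>E {..w}"
  define fill where "fill f i j = (if (i, j) \<in> B then f (i, j) else 0)" for f :: "nat \<times> nat \<Rightarrow> nat" and i j
  define \<Phi> where "\<Phi> f = restrict (\<lambda>(s, i, j). last_passage ((shadow ^^ s) (fill f)) i j) D" for f
  have fill: "fill f i j \<le> w" if "f \<in> F" for f i j
    using that unfolding F_def fill_def by (auto simp: PiE_iff)
  have vanish: "last_passage ((shadow ^^ s) (fill f)) i j = 0" if "k \<le> s" "i + j \<le> Suc L" for f s i j
  proof (rule ccontr)
    assume "\<not> ?thesis"
    then have "has_antichain (fill f) (Suc s) i j" using has_antichain_iterated_shadow by simp
    then obtain a b where ab: "\<And>t. t < Suc s \<Longrightarrow> a t < i \<and> b t < j \<and> 0 < fill f (a t) (b t)"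
      and "\<And>t. Suc t < Suc s \<Longrightarrow> a t < a (Suc t) \<and> b (Suc t) < b t"
      unfolding has_antichain_def by blast
    moreover have "(a t, b t) \<in> B" if "t < Suc s" for t
      using ab[OF that] unfolding fill_def by (auto split: if_splits)
    moreover have "a t + b u < L" if "t < Suc s" "u < Suc s" for t u
      using ab[OF that(1)] ab[OF that(2)] \<open>i + j \<le> Suc L\<close> by linarith
    ultimately have "\<exists>a b. (\<forall>t<Suc k. (a t, b t) \<in> B) \<and> (\<forall>t. Suc t < Suc k \<longrightarrow> a t < a (Suc t) \<and> b (Suc t) < b t)
          \<and> (\<forall>t<Suc k. \<forall>u<Suc k. a t + b u < L)"
      using \<open>k \<le> s\<close> by (intro exI[of _ a] exI[of _ b]) auto
    then show False using no by blast
  qed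
  have inj: "inj_on \<Phi> F"
  proof (rule inj_onI)
    fix f g assume fg: "f \<in> F" "g \<in> F" and eq: "\<Phi> f = \<Phi> g"
    have "last_passage ((shadow ^^ s) (fill f)) i j = last_passage ((shadow ^^ s) (fill g)) i j"
      if "i + j = L \<or> i + j = Suc L" for s i j
    proof (cases "s < k")
      case True
      then have "(s, i, j) \<in> D" using that unfolding D_def E_def by auto
      then show ?thesis using fun_cong[OF eq, of "(s, i, j)"] unfolding \<Phi>_def by simp
    next
      case False
      then show ?thesis using that vanish[of s i j f] vanish[of s i j g] by auto
    qed
    then have *: "fill f i j = fill g i j" if "i + j < L" for i j
      using filling_determined that by blast
    show "f = g"
    proof (rule PiE_ext[OF fg[unfolded F_def]])
      fix p assume p: "p \<in> B"
      obtain i j where "p = (i, j)" by (cases p)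
      with p * [of i j] assms(1)[of i j] show "f p = g p" unfolding fill_def by auto
    qed
  qed
  have "\<Phi> ` F \<subseteq> D \<rightarrow>\<^sub>E {..c * w}"
  proof
    fix h assume "h \<in> \<Phi> ` F"
    then obtain f where f: "f \<in> F" "h = \<Phi> f" by blast
    have "last_passage ((shadow ^^ s) (fill f)) i j \<le> c * w" if "(s, i, j) \<in> D" for s i j
    proof -
      have "last_passage ((shadow ^^ s) (fill f)) i j \<le> Suc L ^ Suc s * w"
        using that unfolding D_def E_def
        by (intro iterated_last_passage_bound[where L = L]) (auto simp: fill[OF f(1)])
      also have "\<dots> \<le> c * w"
        using that unfolding D_def c_def by (intro mult_right_mono power_increasing) auto
      finally show ?thesis .
    qed
    then show "h \<in> D \<rightarrow>\<^sub>E {..c * w}" unfolding f \<Phi>_def by auto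
  qed
  then have "card F \<le> card (D \<rightarrow>\<^sub>E {..c * w})"
    using inj finD by (intro card_inj_on_le[of \<Phi>] finite_PiE) auto
  then have "Suc w ^ card B \<le> Suc (c * w) ^ card D"
    unfolding F_def using finB finD by (simp add: card_funcsetE)
  also have "\<dots> \<le> (c * Suc w) ^ card D"
  proof (rule power_mono)
    have "1 \<le> c" unfolding c_def by (rule one_le_power) simp
    then show "Suc (c * w) \<le> c * Suc w" by simp
  qed simp
  also have "\<dots> = w * Suc w ^ card D" by (simp only: power_mult_distrib w_def[symmetric])
  also have "\<dots> < Suc w * Suc w ^ card D" by simp
  also have "\<dots> = Suc w ^ Suc (card D)" by simp
  also have "\<dots> \<le> Suc w ^ card B" using cardD by (intro power_increasing) auto
  finally show False by simp
qed

section \<open>Density of plane slices\<close>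

definition increasing_pairs :: "(int \<times> int) set \<Rightarrow> nat \<Rightarrow> (nat \<Rightarrow> int) \<Rightarrow> (nat \<Rightarrow> int) \<Rightarrow> bool" where
  "increasing_pairs A m p q \<longleftrightarrow> (\<forall>t<m. (p t, q t) \<in> A) \<and>
     (\<forall>t. Suc t < m \<longrightarrow> p t < p (Suc t) \<and> q t < q (Suc t))"

lemma increasing_pairs_mono:
  assumes "increasing_pairs A m p q" "t < u" "u < m"
  shows "p t < p u \<and> q t < q u"
  using assms(2,3)
proof (induction u)
  case (Suc u)
  have "p u < p (Suc u) \<and> q u < q (Suc u)"
    using assms(1) Suc.prems unfolding increasing_pairs_def by blast
  then show ?case using Suc by (cases "t = u") auto
qed simp

text \<open>The triangle bound after the change of coordinates \<open>(p, q) \<mapsto> (p + K, K - q)\<close>, which turns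
  increasing sequences into antichains and \<open>lo \<le> q - p\<close> into the hypotenuse of a triangle.\<close>

lemma half_plane_density:
  fixes A :: "(int \<times> int) set" and K :: nat
  assumes A: "\<And>p q. (p, q) \<in> A \<Longrightarrow> \<bar>p\<bar> \<le> int K \<and> \<bar>q\<bar> \<le> int K \<and> lo \<le> q - p"
    and lo: "- 2 * int K \<le> lo"
    and large: "k * (8 * K + 5) < card A"
  shows "\<exists>p q. increasing_pairs A (Suc k) p q \<and> (\<forall>t<Suc k. \<forall>u<Suc k. lo \<le> q t - p u)"
proof (rule ccontr)
  assume no: "\<not> ?thesis"
  define \<phi> where "\<phi> = (\<lambda>(p, q). (nat (p + int K), nat (int K - q)))"
  define L where "L = nat (2 * int K - lo + 1)"
  have inj: "inj_on \<phi> A"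
  proof (rule inj_onI)
    fix z z' assume "z \<in> A" "z' \<in> A" "\<phi> z = \<phi> z'"
    then show "z = z'" using A[of "fst z" "snd z"] A[of "fst z'" "snd z'"]
      unfolding \<phi>_def by (auto simp: split_beta prod_eq_iff)
  qed
  have "card (\<phi> ` A) \<le> k * (2 * L + 3)"
  proof (rule triangle_density)
    fix i j assume "(i, j) \<in> \<phi> ` A"
    then obtain p q where "(p, q) \<in> A" "i = nat (p + int K)" "j = nat (int K - q)"
      unfolding \<phi>_def by auto
    then show "i + j < L" using A[of p q] unfolding L_def by auto
  next
    show "\<nexists>a b. (\<forall>t<Suc k. (a t, b t) \<in> \<phi> ` A) \<and>
      (\<forall>t. Suc t < Suc k \<longrightarrow> a t < a (Suc t) \<and> b (Suc t) < b t) \<and>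
      (\<forall>t<Suc k. \<forall>u<Suc k. a t + b u < L)"
    proof (rule notI, elim exE conjE)
      fix a b
      assume mem: "\<forall>t<Suc k. (a t, b t) \<in> \<phi> ` A"
        and ch: "\<forall>t. Suc t < Suc k \<longrightarrow> a t < a (Suc t) \<and> b (Suc t) < b t"
        and box: "\<forall>t<Suc k. \<forall>u<Suc k. a t + b u < L"
      define p where "p t = int (a t) - int K" for t
      define q where "q t = int K - int (b t)" for t
      have "(p t, q t) \<in> A" if t: "t < Suc k" for t
      proof -
        obtain p' q' where "(p', q') \<in> A" "(a t, b t) = \<phi> (p', q')" using mem t by auto
        moreover from this have "p' = p t" "q' = q t"
          using A[of p' q'] unfolding \<phi>_def p_def q_def by auto
        ultimately show ?thesis by simp
      qed
      then have "increasing_pairs A (Suc k) p q"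
        using ch unfolding increasing_pairs_def p_def q_def by auto
      moreover have "lo \<le> q t - p u" if "t < Suc k" "u < Suc k" for t u
        using box[rule_format, OF that(2,1)] unfolding p_def q_def L_def by linarith
      ultimately show False using no by blast
    qed
  qed
  also have "card (\<phi> ` A) = card A" by (rule card_image[OF inj])
  also have "k * (2 * L + 3) \<le> k * (8 * K + 5)"
    using lo unfolding L_def by (intro mult_left_mono) auto
  finally show False using large by simp
qed

text \<open>When all points lie in the lower half of the strip \<open>lo \<le> q - p \<le> hi\<close>, a rectangle spanned by
  them that respects the lower side cannot reach the upper side.\<close>

lemma lower_half_strip_density:
  fixes A :: "(int \<times> int) set" and K :: nat
  assumes A: "\<And>p q. (p, q) \<in> A \<Longrightarrow> \<bar>p\<bar> \<le> int K \<and> \<bar>q\<bar> \<le> int K \<and> lo \<le> q - p \<and> 2 * (q - p) \<le> lo + hi"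
    and lo: "- 2 * int K \<le> lo"
    and large: "k * (8 * K + 5) < card A"
  shows "\<exists>p q. increasing_pairs A (Suc k) p q \<and>
    (\<forall>t<Suc k. \<forall>u<Suc k. lo \<le> q t - p u \<and> q t - p u \<le> hi)"
proof -
  obtain p q where pq: "increasing_pairs A (Suc k) p q"
    and low: "\<And>t u. t < Suc k \<Longrightarrow> u < Suc k \<Longrightarrow> lo \<le> q t - p u"
    using half_plane_density[of A K lo k] A lo large by blast
  have "q t - p u \<le> hi" if "t < Suc k" "u < Suc k" for t u
  proof -
    have "(p t, q t) \<in> A" "(p u, q u) \<in> A" using pq that unfolding increasing_pairs_def by auto
    then have "2 * (q t - p t) \<le> lo + hi" "2 * (q u - p u) \<le> lo + hi" using A by blast+
    moreover have "lo \<le> q u - p t" using low that by blast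
    ultimately have "2 * (q t - p u) \<le> 2 * hi" by (simp add: algebra_simps)
    then show ?thesis by simp
  qed
  with pq low show ?thesis by blast
qed

text \<open>Taking for the sides of the strip the extreme values of \<open>q - p\<close> on the set itself makes
  the conclusion apply to every condition \<open>q - p > c\<close> or \<open>q - p < c\<close> that holds on the set. One of
  the two halves of the strip contains at least half of the points, and exchanging \<open>p\<close> and \<open>q\<close> exchanges the
  halves.\<close>

lemma strip_density:
  fixes A :: "(int \<times> int) set" and K :: nat
  assumes A: "\<And>p q. (p, q) \<in> A \<Longrightarrow> \<bar>p\<bar> \<le> int K \<and> \<bar>q\<bar> \<le> int K"
    and large: "k * (16 * K + 10) < card A"
  shows "\<exists>p q. increasing_pairs A (Suc k) p q \<and>
    (\<forall>t<Suc k. \<forall>u<Suc k. \<exists>z\<in>A. \<exists>z'\<in>A. snd z - fst z \<le> q t - p u \<and> q t - p u \<le> snd z' - fst z')"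
proof -
  have finA: "finite A" using large card_ge_0_finite by force
  have neA: "A \<noteq> {}" using large by auto
  define \<delta> where "\<delta> z = snd z - fst z" for z :: "int \<times> int"
  define lo where "lo = Min (\<delta> ` A)"
  define hi where "hi = Max (\<delta> ` A)"
  have \<delta>: "lo \<le> q - p \<and> q - p \<le> hi" if "(p, q) \<in> A" for p q
  proof -
    have "\<delta> (p, q) \<in> \<delta> ` A" using that by (rule imageI)
    then have "lo \<le> \<delta> (p, q) \<and> \<delta> (p, q) \<le> hi"
      unfolding lo_def hi_def using finA by auto
    then show ?thesis by (simp add: \<delta>_def)
  qed
  have "lo \<in> \<delta> ` A" "hi \<in> \<delta> ` A"
    unfolding lo_def hi_def using finA neA by (auto intro: Min_in Max_in)
  then obtain z z' where z: "z \<in> A" "snd z - fst z = lo" and z': "z' \<in> A" "snd z' - fst z' = hi"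
    unfolding \<delta>_def by blast
  have lohi: "- 2 * int K \<le> lo" "hi \<le> 2 * int K"
    using A[of "fst z" "snd z"] A[of "fst z'" "snd z'"] z z' by auto
  have "\<exists>p q. increasing_pairs A (Suc k) p q \<and>
    (\<forall>t<Suc k. \<forall>u<Suc k. lo \<le> q t - p u \<and> q t - p u \<le> hi)"
  proof -
    define A1 where "A1 = {z\<in>A. 2 * (snd z - fst z) \<le> lo + hi}"
    define A2 where "A2 = {z\<in>A. lo + hi \<le> 2 * (snd z - fst z)}"
    have "A = A1 \<union> A2" unfolding A1_def A2_def by auto
    then have "card A \<le> card A1 + card A2" by (metis card_Un_le)
    then have "k * (8 * K + 5) < card A1 \<or> k * (8 * K + 5) < card A2"
      using large by (auto simp: algebra_simps)
    then show ?thesis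
    proof
      assume "k * (8 * K + 5) < card A1"
      then obtain p q where "increasing_pairs A1 (Suc k) p q"
        "\<forall>t<Suc k. \<forall>u<Suc k. lo \<le> q t - p u \<and> q t - p u \<le> hi"
        using lower_half_strip_density[of A1 K lo hi k] A \<delta> lohi unfolding A1_def by auto
      then show ?thesis unfolding increasing_pairs_def A1_def by blast
    next
      assume *: "k * (8 * K + 5) < card A2"
      define A3 where "A3 = prod.swap ` A2"
      have "card A3 = card A2" unfolding A3_def by (intro card_image) (auto simp: inj_on_def)
      moreover have "\<bar>p\<bar> \<le> int K \<and> \<bar>q\<bar> \<le> int K \<and> - hi \<le> q - p \<and> 2 * (q - p) \<le> - hi + - lo"
        if "(p, q) \<in> A3" for p q
      proof -
        have "(q, p) \<in> A" "lo + hi \<le> 2 * (p - q)" using that unfolding A3_def A2_def by auto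
        then show ?thesis using A[of q p] \<delta>[of q p] by auto
      qed
      ultimately obtain p q where pq: "increasing_pairs A3 (Suc k) p q"
        and b: "\<And>t u. t < Suc k \<Longrightarrow> u < Suc k \<Longrightarrow> - hi \<le> q t - p u \<and> q t - p u \<le> - lo"
        using lower_half_strip_density[of A3 K "- hi" "- lo" k] lohi * by auto
      have "increasing_pairs A (Suc k) q p"
        using pq unfolding increasing_pairs_def A3_def A2_def by auto
      moreover have "lo \<le> p t - q u \<and> p t - q u \<le> hi" if "t < Suc k" "u < Suc k" for t u
        using b[OF that(2,1)] by linarith
      ultimately show ?thesis by blast
    qed
  qed
  then show ?thesis using z z' by metis
qed

section \<open>Density of grids without sign chains\<close>

text \<open>The lists are the sorted edges, or their cells: the coordinate \<open>i\<close> moves in the direction of the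
  sign \<open>s i\<close>, and all coordinates \<open>i\<close> lie below all coordinates \<open>i + 1\<close>, so that any two members form
  the pattern of the signs.\<close>

definition sign_chain :: "(nat \<Rightarrow> int) \<Rightarrow> nat \<Rightarrow> nat \<Rightarrow> (nat \<Rightarrow> nat list) \<Rightarrow> bool" where
  "sign_chain s r m X \<longleftrightarrow>
     (\<forall>t u i. t < u \<longrightarrow> u < m \<longrightarrow> i < r \<longrightarrow> s i * int (X t ! i) < s i * int (X u ! i)) \<and>
     (\<forall>t u i. t < m \<longrightarrow> u < m \<longrightarrow> Suc i < r \<longrightarrow> X t ! i < X u ! Suc i)"

text \<open>In a slice the signed coordinates are, up to constants, alternately \<open>p\<close> and \<open>q\<close>. The condition
  that separates the coordinates \<open>i\<close> and \<open>i + 1\<close> bounds \<open>p + q\<close> if their signs differ, and then it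
  passes from the extreme members of an increasing chain to the whole chain. If the signs agree it bounds
  \<open>q - p\<close> from one side, and \<open>strip_density\<close> supplies a chain that satisfies it for any two
  members.\<close>

lemma slice_sign_chain:
  fixes S :: "nat list set" and s d :: "nat \<Rightarrow> int"
  assumes r: "2 \<le> r" and s: "\<And>i. s i = 1 \<or> s i = -1"
    and S: "\<And>x. x \<in> S \<Longrightarrow> length x = r \<and> sorted_wrt (<) x \<and> (\<forall>v\<in>set x. v < K)"
    and slice: "\<And>x i. x \<in> S \<Longrightarrow> i < r \<Longrightarrow> s i * int (x ! i) = s (i mod 2) * int (x ! (i mod 2)) + d i"
    and large: "k * (16 * K + 10) < card S"
  shows "\<exists>X. (\<forall>t<Suc k. X t \<in> S) \<and> sign_chain s r (Suc k) X"
proof -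
  define \<pi> where "\<pi> x = (s 0 * int (x ! 0), s 1 * int (x ! 1))" for x :: "nat list"
  have inj: "inj_on \<pi> S"
  proof (rule inj_onI)
    fix x y assume xy: "x \<in> S" "y \<in> S" "\<pi> x = \<pi> y"
    show "x = y"
    proof (rule nth_equalityI)
      fix i assume "i < length x"
      then have i: "i < r" using S xy by auto
      have "s (i mod 2) * int (x ! (i mod 2)) = s (i mod 2) * int (y ! (i mod 2))"
        using xy(3) unfolding \<pi>_def by (cases "even i") (auto simp: odd_iff_mod_2_eq_one)
      then have "s i * int (x ! i) = s i * int (y ! i)"
        using slice[OF xy(1) i] slice[OF xy(2) i] by simp
      then show "x ! i = y ! i" using s[of i] by auto
    qed (use S xy in auto)
  qed
  have "\<exists>p q. increasing_pairs (\<pi> ` S) (Suc k) p q \<and>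
    (\<forall>t<Suc k. \<forall>u<Suc k. \<exists>z\<in>\<pi> ` S. \<exists>z'\<in>\<pi> ` S. snd z - fst z \<le> q t - p u \<and> q t - p u \<le> snd z' - fst z')"
  proof (rule strip_density)
    show "k * (16 * K + 10) < card (\<pi> ` S)" using large card_image[OF inj] by simp
  next
    fix p q assume "(p, q) \<in> \<pi> ` S"
    then obtain x where x: "x \<in> S" "p = s 0 * int (x ! 0)" "q = s 1 * int (x ! 1)"
      unfolding \<pi>_def by auto
    have "x ! 0 < K" "x ! 1 < K" using S[OF x(1)] r by auto
    then show "\<bar>p\<bar> \<le> int K \<and> \<bar>q\<bar> \<le> int K" using x s[of 0] s[of 1] by (auto simp: abs_mult)
  qed
  then obtain p q where pq: "increasing_pairs (\<pi> ` S) (Suc k) p q"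
    and box: "\<And>t u. t < Suc k \<Longrightarrow> u < Suc k \<Longrightarrow> \<exists>z\<in>S. \<exists>z'\<in>S.
      snd (\<pi> z) - fst (\<pi> z) \<le> q t - p u \<and> q t - p u \<le> snd (\<pi> z') - fst (\<pi> z')"
    by fastforce
  have "\<forall>t<Suc k. \<exists>x\<in>S. (p t, q t) = \<pi> x" using pq unfolding increasing_pairs_def by blast
  then obtain X where X: "\<And>t. t < Suc k \<Longrightarrow> X t \<in> S \<and> (p t, q t) = \<pi> (X t)" by metis
  define u where "u t i = (if even i then p t else q t)" for t i :: nat
  have slice': "s i * int (x ! i) = (if even i then fst (\<pi> x) else snd (\<pi> x)) + d i"
    if "x \<in> S" "i < r" for x i
    using slice[OF that] unfolding \<pi>_def by (auto simp: odd_iff_mod_2_eq_one)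
  have coord: "s i * int (X t ! i) = u t i + d i" if "t < Suc k" "i < r" for t i
    using slice'[of "X t" i] X[OF that(1)] that(2) unfolding u_def
    by (metis fst_conv snd_conv)
  have mono: "u t i < u t' i" if "t < t'" "t' < Suc k" for t t' i
    using increasing_pairs_mono[OF pq that] unfolding u_def by simp
  have sep: "X t ! i < X t' ! Suc i" if t: "t < Suc k" "t' < Suc k" and i: "Suc i < r" for t t' i
  proof -
    have adj: "int (x ! i) < int (x ! Suc i)" if "x \<in> S" for x
      using S[OF that] i sorted_wrt_nth_less[of "(<)" x i "Suc i"] by auto
    have mono': "u a j \<le> u b j" if "a \<le> b" "b < Suc k" for a b j
      using mono[of a b j] that by (cases "a = b") auto
    consider "s i = 1" "s (Suc i) = -1" | "s i = -1" "s (Suc i) = 1"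
      | "s i = s (Suc i)" using s[of i] s[of "Suc i"] by auto
    then show ?thesis
    proof cases
      case 1
      define m where "m = max t t'"
      have m: "m < Suc k" "t \<le> m" "t' \<le> m" using t unfolding m_def by auto
      show ?thesis using adj[of "X m"] X[of m] coord[of m i] coord[of m "Suc i"] coord[of t i]
          coord[of t' "Suc i"] mono'[of t m i] mono'[of t' m "Suc i"] 1 m t i by auto
    next
      case 2
      define m where "m = min t t'"
      have m: "m < Suc k" "m \<le> t" "m \<le> t'" using t unfolding m_def by auto
      show ?thesis using adj[of "X m"] X[of m] coord[of m i] coord[of m "Suc i"] coord[of t i]
          coord[of t' "Suc i"] mono'[of m t i] mono'[of m t' "Suc i"] 2 m t i by auto
    next
      case 3
      obtain z z' where zz: "z \<in> S" "z' \<in> S" and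
        b: "snd (\<pi> z) - fst (\<pi> z) \<le> (if even i then q t' - p t else q t - p t')"
         "(if even i then q t' - p t else q t - p t') \<le> snd (\<pi> z') - fst (\<pi> z')"
        using box[OF t] box[OF t(2,1)] by (cases "even i") auto
      show ?thesis
        using adj[OF zz(1)] adj[OF zz(2)] b slice'[OF zz(1), of i] slice'[OF zz(2), of i]
          slice'[OF zz(1), of "Suc i"] slice'[OF zz(2), of "Suc i"] 3 s[of i] i
          coord[OF t(1), of i] coord[OF t(2), of "Suc i"] unfolding u_def
        by (auto split: if_splits)
    qed
  qed
  have "sign_chain s r (Suc k) X"
    unfolding sign_chain_def using coord mono sep by auto
  then show ?thesis using X by blast
qed

text \<open>There are at most \<open>(4 * K + 1) ^ (r - 2)\<close> slices, one for each vector of differences between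
  the signed coordinates \<open>i \<ge> 2\<close> and the signed coordinate 0 or 1 of the same parity.\<close>

lemma sign_chain_density:
  fixes S :: "nat list set" and s :: "nat \<Rightarrow> int"
  assumes r: "2 \<le> r" and s: "\<And>i. s i = 1 \<or> s i = -1" and K: "1 \<le> K"
    and S: "\<And>x. x \<in> S \<Longrightarrow> length x = r \<and> sorted_wrt (<) x \<and> (\<forall>v\<in>set x. v < K)"
    and no: "\<nexists>X. (\<forall>t<Suc k. X t \<in> S) \<and> sign_chain s r (Suc k) X"
  shows "card S \<le> 26 * 5 ^ r * k * K ^ (r - 1)"
proof -
  define off where "off x = restrict (\<lambda>i. s i * int (x ! i) - s (i mod 2) * int (x ! (i mod 2))) {2..<r}"
    for x :: "nat list"
  define O' where "O' = {2..<r} \<rightarrow>\<^sub>E {- 2 * int K..2 * int K}"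
  have offO: "off x \<in> O'" if "x \<in> S" for x
  proof -
    have "s i * int (x ! i) - s (i mod 2) * int (x ! (i mod 2)) \<in> {- 2 * int K..2 * int K}"
      if i: "i \<in> {2..<r}" for i
    proof -
      have "i mod 2 < r" using r by (meson less_le_trans mod_less_divisor pos2)
      then have "x ! i < K" "x ! (i mod 2) < K" using S[OF \<open>x \<in> S\<close>] i by auto
      then show ?thesis using s[of i] s[of "i mod 2"] by auto
    qed
    then show ?thesis unfolding off_def O'_def by auto
  qed
  have finO: "finite O'" unfolding O'_def by (intro finite_PiE) auto
  have "card S \<le> card (\<Union>f\<in>O'. {x\<in>S. off x = f})"
  proof (rule card_mono)
    have "S \<subseteq> {x. set x \<subseteq> {..<K} \<and> length x = r}" using S by auto
    then have "finite S" using finite_lists_length_eq[of "{..<K}" r] finite_subset by blast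
    then show "finite (\<Union>f\<in>O'. {x\<in>S. off x = f})" using finO by auto
    show "S \<subseteq> (\<Union>f\<in>O'. {x\<in>S. off x = f})" using offO by auto
  qed
  also have "\<dots> \<le> (\<Sum>f\<in>O'. card {x\<in>S. off x = f})" by (rule card_UN_le[OF finO])
  also have "\<dots> \<le> (\<Sum>f\<in>O'. k * (16 * K + 10))"
  proof (rule sum_mono, rule ccontr)
    fix f assume "\<not> card {x\<in>S. off x = f} \<le> k * (16 * K + 10)"
    then have large: "k * (16 * K + 10) < card {x\<in>S. off x = f}" by simp
    have "\<exists>X. (\<forall>t<Suc k. X t \<in> {x\<in>S. off x = f}) \<and> sign_chain s r (Suc k) X"
    proof (rule slice_sign_chain[OF r s _ _ large])
      fix x i assume x: "x \<in> {x\<in>S. off x = f}" and i: "i < r"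
      show "s i * int (x ! i) = s (i mod 2) * int (x ! (i mod 2)) + (if i < 2 then 0 else f i)"
      proof (cases "i < 2")
        case True
        then show ?thesis by simp
      next
        case False
        have "f i = off x i" using x by simp
        then show ?thesis using False i unfolding off_def by simp
      qed
    qed (use S in auto)
    then show False using no by blast
  qed
  also have "\<dots> = card O' * (k * (16 * K + 10))" by simp
  also have "card O' = (4 * K + 1) ^ (r - 2)"
  proof -
    have "card {- 2 * int K..2 * int K} = 4 * K + 1" by simp
    then show ?thesis unfolding O'_def by (subst card_funcsetE) auto
  qed
  also have "(4 * K + 1) ^ (r - 2) * (k * (16 * K + 10)) \<le> (5 * K) ^ (r - 2) * (k * (26 * K))"
    using K by (intro mult_mono power_mono) auto
  also have "\<dots> = 26 * 5 ^ (r - 2) * k * (K * K ^ (r - 2))"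
    by (simp add: power_mult_distrib algebra_simps)
  also have "K * K ^ (r - 2) = K ^ (r - 1)"
    using r by (metis Suc_diff_le diff_Suc_Suc numeral_2_eq_2 power_Suc diff_Suc_1 Suc_1)
  also have "26 * 5 ^ (r - 2) * k * K ^ (r - 1) \<le> 26 * 5 ^ r * k * K ^ (r - 1)"
    by (intro mult_right_mono mult_left_mono power_increasing) auto
  finally show ?thesis .
qed

section \<open>Partite patterns as sign vectors\<close>

definition first_edge :: "(nat \<Rightarrow> int) \<Rightarrow> nat \<Rightarrow> nat set" where
  "first_edge s r = (\<lambda>i. if s i = 1 then 2 * i + 1 else 2 * i + 2) ` {..<r}"

definition second_edge :: "(nat \<Rightarrow> int) \<Rightarrow> nat \<Rightarrow> nat set" where
  "second_edge s r = (\<lambda>i. if s i = 1 then 2 * i + 2 else 2 * i + 1) ` {..<r}"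

definition sign_pattern :: "(nat \<Rightarrow> int) \<Rightarrow> nat \<Rightarrow> nat set set" where
  "sign_pattern s r = {first_edge s r, second_edge s r}"

lemma mem_edges:
  "2 * i + 1 \<in> first_edge s r \<longleftrightarrow> i < r \<and> s i = 1"
  "2 * i + 2 \<in> first_edge s r \<longleftrightarrow> i < r \<and> s i \<noteq> 1"
  "2 * i + 1 \<in> second_edge s r \<longleftrightarrow> i < r \<and> s i \<noteq> 1"
  "2 * i + 2 \<in> second_edge s r \<longleftrightarrow> i < r \<and> s i = 1"
proof -
  show "2 * i + 1 \<in> first_edge s r \<longleftrightarrow> i < r \<and> s i = 1"
    "2 * i + 2 \<in> first_edge s r \<longleftrightarrow> i < r \<and> s i \<noteq> 1"
    "2 * i + 1 \<in> second_edge s r \<longleftrightarrow> i < r \<and> s i \<noteq> 1"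
    "2 * i + 2 \<in> second_edge s r \<longleftrightarrow> i < r \<and> s i = 1"
    unfolding first_edge_def second_edge_def by (auto simp: image_iff Suc_double_not_eq_double double_not_eq_Suc_double)
qed

lemma partite_pattern_signs:
  assumes pat: "r_pattern r P" and part: "r_partite r 2 P"
  obtains s where "\<And>i. s i = 1 \<or> s i = (-1::int)" "P = sign_pattern s r"
proof -
  have V: "\<And>e. e \<in> P \<Longrightarrow> e \<subseteq> {1..2 * r}" "\<And>v. v \<in> {1..2 * r} \<Longrightarrow> \<exists>!e. e \<in> P \<and> v \<in> e"
    using pat unfolding r_pattern_def r_matching_def by blast+
  obtain A B where AB: "P = {A, B}" "A \<noteq> B"
    using pat unfolding r_pattern_def by (auto simp: card_2_iff)
  have one: "(2 * i + 1 \<in> e) \<noteq> (2 * i + 2 \<in> e)" if "e \<in> P" "i < r" for e i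
  proof -
    have I: "{i * 2 + 1..(i + 1) * 2} = {2 * i + 1, 2 * i + 2}"
      by (rule set_eqI) (simp only: atLeastAtMost_iff insert_iff empty_iff, presburger)
    have "card (e \<inter> {2 * i + 1, 2 * i + 2}) = 1"
      using part[unfolded r_partite_def, rule_format, OF that] by (simp only: I)
    then show ?thesis
      by (cases "2 * i + 1 \<in> e"; cases "2 * i + 2 \<in> e") (simp_all add: Int_insert_right)
  qed
  have AB': "(v \<in> A) \<noteq> (v \<in> B)" if "v \<in> {1..2 * r}" for v
    using V(2)[OF that] AB by blast
  define s where "s i = (if 2 * i + 1 \<in> A then 1 else - 1 :: int)" for i
  have pair: "(\<lambda>i. if 2 * i + 1 \<in> e then 2 * i + 1 else 2 * i + 2) ` {..<r} = e"
    if e: "e \<in> P" for e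
  proof (intro set_eqI iffI)
    fix v assume v: "v \<in> e"
    then have "v \<in> {1..2 * r}" using V(1)[OF e] by blast
    define i where "i = (v - 1) div 2"
    have i: "i < r" "v = 2 * i + 1 \<or> v = 2 * i + 2" using \<open>v \<in> {1..2 * r}\<close> unfolding i_def by auto
    show "v \<in> (\<lambda>i. if 2 * i + 1 \<in> e then 2 * i + 1 else 2 * i + 2) ` {..<r}"
      using i v one[OF e i(1)] by (intro image_eqI[of _ _ i]) auto
  next
    fix v assume "v \<in> (\<lambda>i. if 2 * i + 1 \<in> e then 2 * i + 1 else 2 * i + 2) ` {..<r}"
    then obtain i where "i < r" "v = (if 2 * i + 1 \<in> e then 2 * i + 1 else 2 * i + 2)" by blast
    then show "v \<in> e" using one[OF e, of i] by (auto split: if_splits)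
  qed
  have "A = first_edge s r"
  proof -
    have "first_edge s r = (\<lambda>i. if 2 * i + 1 \<in> A then 2 * i + 1 else 2 * i + 2) ` {..<r}"
      unfolding first_edge_def s_def by (rule image_cong) simp_all
    also have "\<dots> = A" using AB by (intro pair) simp
    finally show ?thesis by simp
  qed
  moreover have "B = second_edge s r"
  proof -
    have "(\<lambda>i. if 2 * i + 1 \<in> B then 2 * i + 1 else 2 * i + 2) ` {..<r} = second_edge s r"
      unfolding second_edge_def s_def
    proof (rule image_cong)
      fix i assume "i \<in> {..<r}"
      then show "(if 2 * i + 1 \<in> B then 2 * i + 1 else 2 * i + 2) =
        (if (if 2 * i + 1 \<in> A then 1 else - 1 :: int) = 1 then 2 * i + 2 else 2 * i + 1)"
        using AB'[of "2 * i + 1"] by auto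
    qed simp
    moreover have "(\<lambda>i. if 2 * i + 1 \<in> B then 2 * i + 1 else 2 * i + 2) ` {..<r} = B"
      using AB by (intro pair) simp
    ultimately show ?thesis by simp
  qed
  ultimately have "P = sign_pattern s r" using AB unfolding sign_pattern_def by simp
  then show thesis using that[of s] unfolding s_def by auto
qed

text \<open>The isomorphism sends the smaller of \<open>x i\<close> and \<open>y i\<close> to \<open>2 * i + 1\<close> and the larger to
  \<open>2 * i + 2\<close>.\<close>

lemma order_isomorphic_sign_pattern:
  fixes x y :: "nat \<Rightarrow> nat"
  assumes sep: "\<And>i. Suc i < r \<Longrightarrow> max (x i) (y i) < min (x (Suc i)) (y (Suc i))"
    and ne: "\<And>i. i < r \<Longrightarrow> x i \<noteq> y i"
    and sgn: "\<And>i. i < r \<Longrightarrow> s i = 1 \<longleftrightarrow> x i < y i"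
  shows "order_isomorphic {x ` {..<r}, y ` {..<r}} (sign_pattern s r)"
proof -
  have sep': "max (x i) (y i) < min (x j) (y j)" if "i < j" "j < r" for i j
    using that
  proof (induction j)
    case (Suc j)
    then show ?case using sep[of j] by (cases "i = j") auto
  qed simp
  \<comment> \<open>The least \<open>i\<close> recovers the pair to which a vertex belongs.\<close>
  define f where "f v = 2 * (LEAST i. v \<le> max (x i) (y i)) + (if \<exists>i<r. v = min (x i) (y i) then 1 else 2)"
    for v
  have idx: "(LEAST i. v \<le> max (x i) (y i)) = i" if "i < r" "v = x i \<or> v = y i" for v i
  proof (rule Least_equality)
    show "v \<le> max (x i) (y i)" using that by auto
    fix j assume "v \<le> max (x j) (y j)"
    then show "i \<le> j" using sep'[of j i] that by (force simp: not_le[symmetric])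
  qed
  have fmin: "f (min (x i) (y i)) = 2 * i + 1" if "i < r" for i
    using idx[of i "min (x i) (y i)"] that unfolding f_def by (auto simp: min_def)
  have fmax: "f (max (x i) (y i)) = 2 * i + 2" if "i < r" for i
  proof -
    have "max (x i) (y i) \<noteq> min (x j) (y j)" if "j < r" for j
      using sep'[of i j] sep'[of j i] ne[of i] \<open>i < r\<close> that by (cases i j rule: linorder_cases) auto
    then show ?thesis using idx[of i "max (x i) (y i)"] that unfolding f_def by (auto simp: max_def)
  qed
  have fx: "f (x i) = (if s i = 1 then 2 * i + 1 else 2 * i + 2)"
    and fy: "f (y i) = (if s i = 1 then 2 * i + 2 else 2 * i + 1)" if "i < r" for i
    using fmin[OF that] fmax[OF that] sgn[OF that] ne[OF that] by (auto simp: min_def max_def)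
  have "strict_mono_on (\<Union>{x ` {..<r}, y ` {..<r}}) f"
  proof (rule strict_mono_onI)
    fix u v assume "u \<in> \<Union>{x ` {..<r}, y ` {..<r}}" "v \<in> \<Union>{x ` {..<r}, y ` {..<r}}" "u < v"
    then obtain i j where i: "i < r" "u = x i \<or> u = y i" and j: "j < r" "v = x j \<or> v = y j" by auto
    consider "i < j" | "i = j" | "j < i" by linarith
    then show "f u < f v"
    proof cases
      case 1
      then show ?thesis using fx fy i j by (auto split: if_splits)
    next
      case 2
      then show ?thesis using fx[of i] fy[of i] i j sgn[of i] ne[of i] \<open>u < v\<close> by (auto split: if_splits)
    next
      case 3
      then show ?thesis using sep'[of j i] i j \<open>u < v\<close> by auto
    qed
  qed
  moreover have "f ` x ` {..<r} = first_edge s r" "f ` y ` {..<r} = second_edge s r"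
    unfolding first_edge_def second_edge_def image_image using fx fy by auto
  ultimately show ?thesis unfolding order_isomorphic_def sign_pattern_def by (intro exI[of _ f]) auto
qed

text \<open>A strictly monotone map from \<open>2 * r\<close> vertices onto \<open>{1..2 * r}\<close> has no freedom, so it is the map
  of the previous lemma. The two edges may correspond to the two edges of the pattern in either
  order, hence the two alternatives.\<close>

lemma sign_pattern_of_order_isomorphic:
  fixes x y :: "nat \<Rightarrow> nat"
  assumes iso: "order_isomorphic {x ` {..<r}, y ` {..<r}} (sign_pattern s r)"
    and sep: "\<And>i. Suc i < r \<Longrightarrow> max (x i) (y i) < min (x (Suc i)) (y (Suc i))"
    and ne: "\<And>i. i < r \<Longrightarrow> x i \<noteq> y i"
  shows "(\<forall>i<r. s i = 1 \<longleftrightarrow> x i < y i) \<or> (\<forall>i<r. s i = 1 \<longleftrightarrow> y i < x i)"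
proof -
  obtain g where g: "strict_mono_on (x ` {..<r} \<union> y ` {..<r}) g"
    and img: "(\<lambda>e. g ` e) ` {x ` {..<r}, y ` {..<r}} = {first_edge s r, second_edge s r}"
    using iso unfolding order_isomorphic_def sign_pattern_def by auto
  define l h where "l i = min (x i) (y i)" and "h i = max (x i) (y i)" for i
  have U: "l i \<in> x ` {..<r} \<union> y ` {..<r}" "h i \<in> x ` {..<r} \<union> y ` {..<r}" if "i < r" for i
    using that unfolding l_def h_def by (auto simp: min_def max_def)
  have rng: "1 \<le> g v \<and> g v \<le> 2 * r" if "v \<in> x ` {..<r} \<union> y ` {..<r}" for v
  proof -
    have "g v \<in> \<Union>((\<lambda>e. g ` e) ` {x ` {..<r}, y ` {..<r}})" using that by auto
    then show ?thesis unfolding img first_edge_def second_edge_def by (auto split: if_splits)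
  qed
  have lh: "g (l i) < g (h i)" if "i < r" for i
    using strict_mono_onD[OF g U[OF that]] ne[OF that] unfolding l_def h_def by (auto simp: min_def max_def)
  have hl: "g (h i) < g (l (Suc i))" if "Suc i < r" for i
    using strict_mono_onD[OF g U(2)[of i] U(1)[of "Suc i"]] sep[OF that] that unfolding l_def h_def by auto
  have low: "2 * i + 1 \<le> g (l i)" if "i < r" for i
    using that
  proof (induction i)
    case 0
    then show ?case using rng[OF U(1)[of 0]] by simp
  next
    case (Suc i)
    then have "2 * i + 1 \<le> g (l i)" "g (l i) < g (h i)" "g (h i) < g (l (Suc i))"
      using lh[of i] hl[of i] by auto
    then show ?case by simp
  qed
  have up: "g (h i) \<le> 2 * i + 2" if "i < r" for i
    using that
  proof (induction "r - Suc i" arbitrary: i)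
    case 0
    then show ?case using rng[OF U(2)[of i]] by auto
  next
    case (Suc d)
    then have "Suc i < r" by linarith
    moreover from this have "g (h (Suc i)) \<le> 2 * Suc i + 2"
      using Suc.hyps(1)[of "Suc i"] Suc.hyps(2) by simp
    ultimately show ?case using lh[of "Suc i"] hl[of i] by simp
  qed
  have gl: "g (l i) = 2 * i + 1" and gh: "g (h i) = 2 * i + 2" if "i < r" for i
    using low[OF that] up[OF that] lh[OF that] by simp_all
  have gx: "g (x i) = (if x i < y i then 2 * i + 1 else 2 * i + 2)" if "i < r" for i
    using gl[OF that] gh[OF that] ne[OF that] unfolding l_def h_def by (auto simp: min_def max_def)
  have mem: "g (x i) \<in> g ` x ` {..<r}" if "i < r" for i using that by auto
  have "g ` x ` {..<r} \<in> (\<lambda>e. g ` e) ` {x ` {..<r}, y ` {..<r}}" by (intro imageI) simp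
  then have "g ` x ` {..<r} = first_edge s r \<or> g ` x ` {..<r} = second_edge s r"
    unfolding img by (simp only: insert_iff empty_iff simp_thms)
  then show ?thesis
  proof
    assume *: "g ` x ` {..<r} = first_edge s r"
    have "s i = 1 \<longleftrightarrow> x i < y i" if i: "i < r" for i
      using mem[OF i] gx[OF i] unfolding *
      by (cases "x i < y i") (use mem_edges(1,2)[of i s r] in auto)
    then show ?thesis by blast
  next
    assume *: "g ` x ` {..<r} = second_edge s r"
    have "s i = 1 \<longleftrightarrow> y i < x i" if i: "i < r" for i
      using mem[OF i] gx[OF i] ne[OF i] unfolding *
      by (cases "x i < y i") (use mem_edges(3,4)[of i s r] in auto)
    then show ?thesis by blast
  qed
qed

lemma le_max_clique_size:
  assumes "finite M" "K \<subseteq> M" "is_clique P K"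
  shows "card K \<le> max_clique_size P M"
proof -
  have "{card K |K. K \<subseteq> M \<and> is_clique P K} \<subseteq> {..card M}"
    using assms(1) by (auto intro: card_mono)
  then have "finite {card K |K. K \<subseteq> M \<and> is_clique P K}" using finite_subset by blast
  then show ?thesis unfolding max_clique_size_def using assms by (intro Max_ge) auto
qed

lemma max_clique_size_attained:
  assumes "finite M"
  obtains K where "K \<subseteq> M" "is_clique P K" "card K = max_clique_size P M"
proof -
  have "{card K |K. K \<subseteq> M \<and> is_clique P K} \<subseteq> {..card M}"
    using assms(1) by (auto intro: card_mono)
  then have fin: "finite {card K |K. K \<subseteq> M \<and> is_clique P K}" using finite_subset by blast
  have "is_clique P {}" unfolding is_clique_def by simp
  then have "{card K |K. K \<subseteq> M \<and> is_clique P K} \<noteq> {}" by blast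
  from Max_in[OF fin this] show thesis using that unfolding max_clique_size_def by auto
qed

lemma r_matching_finite: "r_matching r V M \<Longrightarrow> finite M"
  unfolding r_matching_def by (meson PowI finite_Pow_iff finite_subset subsetI)

lemma r_matching_card:
  assumes M: "r_matching r {1..r * n} M" and r: "1 \<le> r"
  shows "card M = n"
proof -
  have "r * card M = card (\<Union>M)"
  proof (rule card_partition)
    show "finite M" by (rule r_matching_finite[OF M])
    show "finite (\<Union>M)"
      by (rule finite_subset[of _ "{1..r * n}"]) (use M in \<open>auto simp: r_matching_def\<close>)
    show "card c = r" if "c \<in> M" for c using M that unfolding r_matching_def by blast
    show "c1 \<inter> c2 = {}" if "c1 \<in> M" "c2 \<in> M" "c1 \<noteq> c2" for c1 c2
      using M that unfolding r_matching_def by blast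
  qed
  also have "\<Union>M = {1..r * n}" using M unfolding r_matching_def by blast
  finally show ?thesis using r by simp
qed

lemma max_clique_size_ge_sign_chain:
  assumes M: "r_matching r V M" and r: "1 \<le> r" and s: "\<And>i. s i = 1 \<or> s i = (-1::int)"
    and e: "\<And>t. t < m \<Longrightarrow> e t \<in> M"
    and chain: "sign_chain s r m (\<lambda>t. sorted_list_of_set (e t))"
  shows "m \<le> max_clique_size (sign_pattern s r) M"
proof -
  let ?y = "\<lambda>t. sorted_list_of_set (e t)"
  have fin: "finite (e t)" "length (?y t) = r" if "t < m" for t
    using M e[OF that] unfolding r_matching_def by (auto intro: finite_subset)
  have eset: "e t = (\<lambda>i. ?y t ! i) ` {..<r}" if "t < m" for t
    using fin[OF that] set_conv_nth[of "?y t"] by auto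
  have iso: "order_isomorphic {e t, e u} (sign_pattern s r)" if tu: "t < u" "u < m" for t u
  proof -
    have sg: "s i * int (?y t ! i) < s i * int (?y u ! i)" if "i < r" for i
      using chain tu that unfolding sign_chain_def by blast
    have "order_isomorphic {(\<lambda>i. ?y t ! i) ` {..<r}, (\<lambda>i. ?y u ! i) ` {..<r}} (sign_pattern s r)"
    proof (rule order_isomorphic_sign_pattern)
      fix i assume "Suc i < r"
      then show "max (?y t ! i) (?y u ! i) < min (?y t ! Suc i) (?y u ! Suc i)"
        using chain tu unfolding sign_chain_def by auto
    next
      fix i assume i: "i < r"
      show "?y t ! i \<noteq> ?y u ! i" using sg[OF i] by auto
      show "s i = 1 \<longleftrightarrow> ?y t ! i < ?y u ! i" using sg[OF i] s[of i] by auto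
    qed
    then show ?thesis using eset[of t] eset[of u] tu by simp
  qed
  have ne: "e t \<noteq> e u" if "t < u" "u < m" for t u
  proof
    assume "e t = e u"
    moreover have "s 0 * int (?y t ! 0) < s 0 * int (?y u ! 0)"
      using chain that r unfolding sign_chain_def by auto
    ultimately show False by simp
  qed
  have inj: "inj_on e {..<m}"
  proof (rule inj_onI)
    fix t u assume "t \<in> {..<m}" "u \<in> {..<m}" "e t = e u"
    then show "t = u" using ne[of t u] ne[of u t] by (cases t u rule: linorder_cases) auto
  qed
  have "card (e ` {..<m}) \<le> max_clique_size (sign_pattern s r) M"
  proof (rule le_max_clique_size[OF r_matching_finite[OF M]])
    show "e ` {..<m} \<subseteq> M" using e by auto
    show "is_clique (sign_pattern s r) (e ` {..<m})"
      unfolding is_clique_def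
    proof (intro ballI impI)
      fix a b assume "a \<in> e ` {..<m}" "b \<in> e ` {..<m}" "a \<noteq> b"
      then obtain t u where "t < m" "u < m" "a = e t" "b = e u" "t \<noteq> u" by auto
      then show "order_isomorphic {a, b} (sign_pattern s r)"
        using iso[of t u] iso[of u t] by (cases t u rule: linorder_cases) (auto simp: insert_commute)
    qed
  qed
  then show ?thesis by (simp add: card_image[OF inj])
qed

section \<open>Dyadic cells of a matching\<close>

lemma card_lists_with_image:
  assumes "\<And>c. finite {v\<in>V. f v = c} \<and> card {v\<in>V. f v = c} \<le> S"
  shows "finite {y. set y \<subseteq> V \<and> map f y = \<tau>} \<and> card {y. set y \<subseteq> V \<and> map f y = \<tau>} \<le> S ^ length \<tau>"
proof (induction \<tau>)
  case Nil
  have "{y. set y \<subseteq> V \<and> map f y = []} = {[]}" by auto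
  then show ?case by simp
next
  case (Cons c \<tau>)
  let ?F = "{v\<in>V. f v = c}" and ?Y = "{y. set y \<subseteq> V \<and> map f y = \<tau>}"
  have eq: "{y. set y \<subseteq> V \<and> map f y = c # \<tau>} = (\<lambda>(v, y). v # y) ` (?F \<times> ?Y)"
    by (auto simp: map_eq_Cons_conv image_iff)
  have "card ((\<lambda>(v, y). v # y) ` (?F \<times> ?Y)) \<le> card (?F \<times> ?Y)"
    using Cons assms[of c] by (intro card_image_le) auto
  also have "\<dots> \<le> S * S ^ length \<tau>"
    using Cons assms[of c] by (simp add: card_cartesian_product mult_mono)
  finally show ?case unfolding eq using Cons assms[of c] by auto
qed

text \<open>The vertices \<open>{1..N}\<close> are cut into \<open>2 ^ j\<close> intervals by rounding, so that the partitions are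
  nested although \<open>N\<close> is arbitrary.\<close>

definition block :: "nat \<Rightarrow> nat \<Rightarrow> nat \<Rightarrow> nat" where
  "block N j v = (v - 1) * 2 ^ j div N"

lemma block_less:
  assumes "v \<in> {1..N}"
  shows "block N j v < 2 ^ j"
  unfolding block_def using assms by (intro less_mult_imp_div_less) (auto simp: mult.commute)

lemma block_mono: "u \<le> v \<Longrightarrow> block N j u \<le> block N j v"
  unfolding block_def by (intro div_le_mono mult_right_mono diff_le_mono) auto

lemma block_less_imp: "block N j u < block N j v \<Longrightarrow> u < v"
  using block_mono[of v u N j] by (meson leD leI)

lemma block_Suc: "block N (Suc j) v div 2 = block N j v"
proof -
  have "block N (Suc j) v div 2 = (v - 1) * 2 ^ j * 2 div (N * 2)"
    unfolding block_def by (simp add: div_mult2_eq mult_ac)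
  then show ?thesis unfolding block_def by simp
qed

lemma card_block_fibre:
  assumes "0 < N"
  shows "finite {v\<in>{1..N}. block N j v = c} \<and> card {v\<in>{1..N}. block N j v = c} \<le> N div 2 ^ j + 1"
proof -
  let ?F = "{v\<in>{1..N}. block N j v = c}"
  have fin: "finite ?F" by simp
  have "card ?F \<le> N div 2 ^ j + 1"
  proof (cases "?F = {}")
    case False
    \<comment> \<open>Two vertices of one block differ by at most \<open>N div 2 ^ j\<close>.\<close>
    define a where "a = Min ?F"
    have a: "a \<in> ?F" unfolding a_def using Min_in[OF fin False] .
    have "?F \<subseteq> {a..a + N div 2 ^ j}"
    proof
      fix v assume v: "v \<in> ?F"
      have av: "a \<le> v" unfolding a_def using fin v by simp
      have "(v - 1) * 2 ^ j < c * N + N"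
        using dividend_less_times_div[OF assms, of "(v - 1) * 2 ^ j"] v
        unfolding block_def by (simp add: mult.commute)
      moreover have "c * N \<le> (a - 1) * 2 ^ j"
      proof -
        have "c = (a - 1) * 2 ^ j div N" using a unfolding block_def by simp
        then show ?thesis by (simp only: div_times_less_eq_dividend)
      qed
      ultimately have "(v - 1) * 2 ^ j < (a - 1) * 2 ^ j + N" by simp
      moreover have "(v - 1) * 2 ^ j = (v - a) * 2 ^ j + (a - 1) * 2 ^ j"
        using av a by (simp flip: add_mult_distrib)
      ultimately have "(v - a) * 2 ^ j \<le> N" by simp
      then have "v - a \<le> N div 2 ^ j" by (simp add: less_eq_div_iff_mult_less_eq)
      then show "v \<in> {a..a + N div 2 ^ j}" using av by auto
    qed
    then have "card ?F \<le> card {a..a + N div 2 ^ j}" by (intro card_mono) auto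
    then show ?thesis by simp
  next
    case True
    show ?thesis unfolding True by simp
  qed
  then show ?thesis using fin by blast
qed

definition cell :: "nat \<Rightarrow> nat \<Rightarrow> nat set \<Rightarrow> nat list" where
  "cell N j e = map (block N j) (sorted_list_of_set e)"

text \<open>Some entry is repeated at neighbouring positions, so the list arises from a list of length
  \<open>r - 1\<close> by doubling one entry.\<close>

lemma card_nonstrict_sorted_lists:
  assumes "1 \<le> r"
  shows "finite {x. length x = r \<and> set x \<subseteq> {..<K::nat} \<and> sorted x \<and> \<not> sorted_wrt (<) x}
    \<and> card {x. length x = r \<and> set x \<subseteq> {..<K::nat} \<and> sorted x \<and> \<not> sorted_wrt (<) x} \<le> r * K ^ (r - 1)"
proof -
  let ?L = "{y. set y \<subseteq> {..<K} \<and> length y = r - 1}"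
  let ?g = "\<lambda>(i, y). take i y @ y ! i # drop i y"
  have fin: "finite ({..<r} \<times> ?L)" using finite_lists_length_eq[of "{..<K}" "r - 1"] by simp
  have sub: "{x. length x = r \<and> set x \<subseteq> {..<K} \<and> sorted x \<and> \<not> sorted_wrt (<) x} \<subseteq> ?g ` ({..<r} \<times> ?L)"
  proof
    fix x assume x: "x \<in> {x. length x = r \<and> set x \<subseteq> {..<K} \<and> sorted x \<and> \<not> sorted_wrt (<) x}"
    then have "\<not> distinct x" using strict_sorted_iff[of x] by auto
    then have "\<exists>i. Suc i < r \<and> x ! i = x ! Suc i"
    proof -
      obtain a b where ab: "a < b" "b < r" "x ! a = x ! b"
        using \<open>\<not> distinct x\<close> x unfolding distinct_conv_nth by (metis (mono_tags, lifting) linorder_neqE_nat mem_Collect_eq)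
      have "x ! a \<le> x ! Suc a" "x ! Suc a \<le> x ! b"
        using x ab sorted_nth_mono[of x a "Suc a"] sorted_nth_mono[of x "Suc a" b] by auto
      with ab show ?thesis by (intro exI[of _ a]) auto
    qed
    then obtain i where i: "Suc i < r" "x ! i = x ! Suc i" by blast
    define y where "y = take i x @ drop (Suc i) x"
    have "y ! i = x ! i" unfolding y_def using i x by (auto simp: nth_append)
    moreover have "take i y = take i x" "drop i y = drop (Suc i) x"
      unfolding y_def using i x by auto
    ultimately have "x = ?g (i, y)" using i x id_take_nth_drop[of i x] by simp
    moreover have "y \<in> ?L"
      unfolding y_def using i x by (auto dest: in_set_takeD in_set_dropD)
    ultimately show "x \<in> ?g ` ({..<r} \<times> ?L)" using i by (intro image_eqI[of _ _ "(i, y)"]) auto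
  qed
  have "card (?g ` ({..<r} \<times> ?L)) \<le> card ({..<r} \<times> ?L)" by (rule card_image_le[OF fin])
  also have "\<dots> = r * K ^ (r - 1)" by (simp add: card_cartesian_product card_lists_length_eq)
  finally have "card (?g ` ({..<r} \<times> ?L)) \<le> r * K ^ (r - 1)" .
  moreover have "finite (?g ` ({..<r} \<times> ?L))" using fin by (rule finite_imageI)
  ultimately show ?thesis using sub by (meson card_mono finite_subset le_trans)
qed

text \<open>The first summand bounds the cells with strictly increasing coordinates (\<open>sign_chain_density\<close>),
  the second those with a repeated coordinate.\<close>

definition cell_density :: "nat \<Rightarrow> nat" where
  "cell_density r = 26 * 5 ^ r + r"

text \<open>Cells with strictly increasing coordinates contain no long sign chain, since edges chosen from the
  cells of such a chain would form a clique; cells with a repeated coordinate are few anyway.\<close>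

lemma card_cells_le:
  assumes M: "r_matching r {1..N} M" and r: "2 \<le> r" and s: "\<And>i. s i = 1 \<or> s i = (-1::int)"
    and k: "1 \<le> k" and small: "max_clique_size (sign_pattern s r) M \<le> k"
  shows "card (cell N j ` M) \<le> cell_density r * k * 2 ^ (j * (r - 1))"
proof -
  define T where "T = cell N j ` M"
  have T: "length x = r \<and> set x \<subseteq> {..<2 ^ j} \<and> sorted x" if xT: "x \<in> T" for x
  proof -
    obtain e where e: "e \<in> M" "x = cell N j e" using xT unfolding T_def by blast
    have "e \<subseteq> {1..N}" "card e = r" using M e(1) unfolding r_matching_def by auto
    moreover from this have "finite e" using finite_subset by blast
    moreover have "sorted (map (block N j) (sorted_list_of_set e))"
      using sorted_sorted_list_of_set[of e] by (intro sorted_map_mono) (auto intro: block_mono monoI mono_onI)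
    ultimately show ?thesis unfolding e(2) cell_def using block_less[of _ N j] by auto
  qed
  define T1 where "T1 = {x\<in>T. sorted_wrt (<) x}"
  define T2 where "T2 = {x\<in>T. \<not> sorted_wrt (<) x}"
  have "card T1 \<le> 26 * 5 ^ r * k * (2 ^ j) ^ (r - 1)"
  proof (rule sign_chain_density[OF r s])
    show "1 \<le> (2::nat) ^ j" by simp
    show "length x = r \<and> sorted_wrt (<) x \<and> (\<forall>v\<in>set x. v < 2 ^ j)" if "x \<in> T1" for x
      using T[of x] that unfolding T1_def by auto
    show "\<nexists>X. (\<forall>t<Suc k. X t \<in> T1) \<and> sign_chain s r (Suc k) X"
    proof (rule notI, elim exE conjE)
      fix X assume X: "\<forall>t<Suc k. X t \<in> T1" "sign_chain s r (Suc k) X"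
      have "\<forall>t<Suc k. \<exists>e\<in>M. X t = cell N j e" using X(1) unfolding T1_def T_def by blast
      then obtain e where e: "\<And>t. t < Suc k \<Longrightarrow> e t \<in> M \<and> X t = cell N j (e t)" by metis
      have nth: "X t ! i = block N j (sorted_list_of_set (e t) ! i)" if "t < Suc k" "i < r" for t i
      proof -
        have "length (X t) = r" using X(1) T that(1) unfolding T1_def by blast
        then show ?thesis using e[OF that(1)] that(2) unfolding cell_def by auto
      qed
      have "sign_chain s r (Suc k) (\<lambda>t. sorted_list_of_set (e t))"
        unfolding sign_chain_def
      proof (intro conjI allI impI)
        fix t u i assume tu: "t < u" "u < Suc k" "i < r"
        then have "s i * int (X t ! i) < s i * int (X u ! i)"
          using X(2) unfolding sign_chain_def by blast
        then show "s i * int (sorted_list_of_set (e t) ! i) < s i * int (sorted_list_of_set (e u) ! i)"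
          using nth[of t i] nth[of u i] tu s[of i] by (auto dest: block_less_imp)
      next
        fix t u i assume tu: "t < Suc k" "u < Suc k" "Suc i < r"
        then have "X t ! i < X u ! Suc i"
          using X(2) unfolding sign_chain_def by blast
        then show "sorted_list_of_set (e t) ! i < sorted_list_of_set (e u) ! Suc i"
          using nth[of t i] nth[of u "Suc i"] tu by (auto dest: block_less_imp)
      qed
      then have "Suc k \<le> max_clique_size (sign_pattern s r) M"
        using M r s e by (intro max_clique_size_ge_sign_chain) auto
      then show False using small by simp
    qed
  qed
  moreover have "card T2 \<le> r * (2 ^ j) ^ (r - 1)"
  proof -
    have "T2 \<subseteq> {x. length x = r \<and> set x \<subseteq> {..<2 ^ j} \<and> sorted x \<and> \<not> sorted_wrt (<) x}"
      using T unfolding T2_def by blast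
    then show ?thesis using card_nonstrict_sorted_lists[of r "2 ^ j"] r
      by (meson card_mono le_trans one_le_numeral)
  qed
  moreover have "r * (2 ^ j) ^ (r - 1) \<le> r * k * (2 ^ j) ^ (r - 1)" using k by simp
  moreover have "card T \<le> card T1 + card T2"
  proof -
    have "T = T1 \<union> T2" unfolding T1_def T2_def by auto
    then show ?thesis by (metis card_Un_le)
  qed
  ultimately have "card T \<le> 26 * 5 ^ r * k * (2 ^ j) ^ (r - 1) + r * k * (2 ^ j) ^ (r - 1)"
    by linarith
  then show ?thesis unfolding T_def cell_density_def by (simp add: power_mult add_mult_distrib)
qed

section \<open>The upper bound\<close>

lemma finite_r_matchings: "finite {M. r_matching r {1..N::nat} M \<and> Q M}"
  by (rule finite_subset[of _ "Pow (Pow {1..N})"]) (auto simp: r_matching_def)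

lemma cell_Suc: "map (\<lambda>v. v div 2) (cell N (Suc j) e) = cell N j e"
  unfolding cell_def by (simp add: block_Suc)

text \<open>Each occupied cell at the next scale lies in one of the at most \<open>2 ^ r\<close> parts of an occupied cell
  at the present scale, so a family of \<open>t\<close> cells has at most \<open>2 ^ (2 ^ r * t)\<close> refinements.\<close>

lemma card_cell_families:
  assumes r: "2 \<le> r" and s: "\<And>i. s i = 1 \<or> s i = (-1::int)" and k: "1 \<le> k"
    and F: "F = {M. r_matching r {1..N} M \<and> max_clique_size (sign_pattern s r) M \<le> k}"
  shows "card ((\<lambda>M. cell N j ` M) ` F) \<le> 2 ^ (1 + 2 ^ r * cell_density r * k * (\<Sum>i<j. 2 ^ (i * (r - 1))))"
proof (induction j)
  case 0
  have "cell N 0 e = replicate r 0" if "M \<in> F" "e \<in> M" for M e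
  proof -
    have e: "e \<subseteq> {1..N}" "card e = r" using that unfolding F r_matching_def by auto
    then have fe: "finite e" using finite_subset by blast
    have "map (block N 0) (sorted_list_of_set e) = map (\<lambda>_. 0) (sorted_list_of_set e)"
      by (rule map_cong) (use e fe block_less[of _ N 0] in auto)
    then show ?thesis unfolding cell_def using e fe by (simp add: map_replicate_const)
  qed
  then have "(\<lambda>M. cell N 0 ` M) ` F \<subseteq> Pow {replicate r 0}" by auto
  then have "card ((\<lambda>M. cell N 0 ` M) ` F) \<le> card (Pow {replicate r (0::nat)})"
    by (intro card_mono) auto
  then show ?case by (simp add: card_Pow)
next
  case (Suc j)
  let ?T = "\<lambda>j. (\<lambda>M. cell N j ` M) ` F"
  let ?D = "cell_density r * k * 2 ^ (j * (r - 1))"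
  have finF: "finite F" unfolding F by (rule finite_r_matchings)
  define ref where "ref \<tau> = {y. set y \<subseteq> UNIV \<and> map (\<lambda>v::nat. v div 2) y = \<tau>}" for \<tau>
  have ref: "finite (ref \<tau>) \<and> card (ref \<tau>) \<le> 2 ^ length \<tau>" for \<tau>
    unfolding ref_def
  proof (rule card_lists_with_image)
    fix c :: nat
    have "{v \<in> UNIV. v div 2 = c} = {2 * c, 2 * c + 1}" by auto
    then show "finite {v \<in> UNIV. v div 2 = c} \<and> card {v \<in> UNIV. v div 2 = c} \<le> 2"
      by (simp add: card_insert_if)
  qed
  have refT: "finite (\<Union>\<tau>\<in>T. ref \<tau>) \<and> card (\<Union>\<tau>\<in>T. ref \<tau>) \<le> 2 ^ r * ?D" if "T \<in> ?T j" for T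
  proof -
    obtain M where M: "M \<in> F" "T = cell N j ` M" using \<open>T \<in> ?T j\<close> by blast
    have finT: "finite T" unfolding M(2) using M(1) r_matching_finite unfolding F by blast
    have len: "length \<tau> = r" if "\<tau> \<in> T" for \<tau>
      using that M unfolding F r_matching_def cell_def by auto
    have "card (\<Union>\<tau>\<in>T. ref \<tau>) \<le> (\<Sum>\<tau>\<in>T. card (ref \<tau>))" by (rule card_UN_le[OF finT])
    also have "\<dots> \<le> (\<Sum>\<tau>\<in>T. 2 ^ r)"
      using ref len by (intro sum_mono) metis
    also have "\<dots> = 2 ^ r * card T" by simp
    also have "\<dots> \<le> 2 ^ r * ?D"
      using card_cells_le[OF _ r s k, where N = N and M = M and j = j] M unfolding F by (intro mult_left_mono) auto
    finally show ?thesis using finT ref by blast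
  qed
  have sub: "?T (Suc j) \<subseteq> (\<Union>T\<in>?T j. Pow (\<Union>\<tau>\<in>T. ref \<tau>))"
  proof
    fix T' assume "T' \<in> ?T (Suc j)"
    then obtain M where M: "M \<in> F" "T' = cell N (Suc j) ` M" by blast
    have "T' \<subseteq> (\<Union>\<tau>\<in>cell N j ` M. ref \<tau>)"
      unfolding M(2) ref_def using cell_Suc[of N j] by auto
    then show "T' \<in> (\<Union>T\<in>?T j. Pow (\<Union>\<tau>\<in>T. ref \<tau>))" using M(1) by blast
  qed
  have "card (?T (Suc j)) \<le> card (\<Union>T\<in>?T j. Pow (\<Union>\<tau>\<in>T. ref \<tau>))"
  proof (rule card_mono[OF _ sub])
    show "finite (\<Union>T\<in>?T j. Pow (\<Union>\<tau>\<in>T. ref \<tau>))"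
      using finF refT by (intro finite_UN_I) auto
  qed
  also have "\<dots> \<le> (\<Sum>T\<in>?T j. card (Pow (\<Union>\<tau>\<in>T. ref \<tau>)))"
    using finF by (intro card_UN_le) simp
  also have "\<dots> \<le> (\<Sum>T\<in>?T j. 2 ^ (2 ^ r * ?D))"
    using refT by (intro sum_mono) (simp add: card_Pow del: UN_simps)
  also have "\<dots> = card (?T j) * 2 ^ (2 ^ r * ?D)" by simp
  also have "\<dots> \<le> 2 ^ (1 + 2 ^ r * cell_density r * k * (\<Sum>i<j. 2 ^ (i * (r - 1)))) * 2 ^ (2 ^ r * ?D)"
    by (intro mult_right_mono Suc.IH) simp
  also have "\<dots> = 2 ^ (1 + 2 ^ r * cell_density r * k * (\<Sum>i<Suc j. 2 ^ (i * (r - 1))))"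
    by (simp add: power_add[symmetric] algebra_simps)
  finally show ?case .
qed

lemma sum_powers_le:
  assumes "2 \<le> r"
  shows "(\<Sum>i<j. (2::nat) ^ (i * (r - 1))) \<le> 2 ^ (j * (r - 1))"
proof (induction j)
  case (Suc j)
  have "(\<Sum>i<Suc j. (2::nat) ^ (i * (r - 1))) \<le> 2 * 2 ^ (j * (r - 1))" using Suc by simp
  also have "\<dots> = 2 ^ (Suc (j * (r - 1)))" by simp
  also have "\<dots> \<le> 2 ^ (Suc j * (r - 1))" using assms by (intro power_increasing) auto
  finally show ?case .
qed simp

text \<open>The first factor counts the families of occupied cells at the scale \<open>J\<close>, the second the choices
  of \<open>n\<close> edges among those that lie in the occupied cells.\<close>

lemma num_matchings_upper:
  assumes r: "2 \<le> r" and s: "\<And>i. s i = 1 \<or> s i = (-1::int)" and k: "1 \<le> k" and n: "1 \<le> n"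
    and J: "k * 2 ^ (J * (r - 1)) \<le> n"
  shows "num_matchings r (sign_pattern s r) (Suc k) n \<le> 2 ^ (1 + 2 ^ r * cell_density r * n) *
    ((cell_density r * n * (r * n div 2 ^ J + 1) ^ r) choose n)"
proof -
  define N where "N = r * n"
  define S where "S = N div 2 ^ J + 1"
  define D where "D = cell_density r"
  have N: "0 < N" unfolding N_def using r n by simp
  define F where "F = {M. r_matching r {1..N} M \<and> max_clique_size (sign_pattern s r) M \<le> k}"
  let ?T = "(\<lambda>M. cell N J ` M) ` F"
  have finF: "finite F" unfolding F_def by (rule finite_r_matchings)
  define U where "U T = (\<Union>\<tau>\<in>T. set ` {y. set y \<subseteq> {1..N} \<and> map (block N J) y = \<tau>})" for T
  have one: "finite {y. set y \<subseteq> {1..N} \<and> map (block N J) y = \<tau>}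
      \<and> card {y. set y \<subseteq> {1..N} \<and> map (block N J) y = \<tau>} \<le> S ^ length \<tau>" for \<tau>
    unfolding S_def by (rule card_lists_with_image) (rule card_block_fibre[OF N])
  have U: "finite (U T) \<and> card (U T) \<le> D * n * S ^ r" if "T \<in> ?T" for T
  proof -
    obtain M where M: "M \<in> F" "T = cell N J ` M" using \<open>T \<in> ?T\<close> by blast
    have finT: "finite T" unfolding M(2) using M(1) r_matching_finite unfolding F_def by blast
    have len: "length \<tau> = r" if "\<tau> \<in> T" for \<tau>
      using that M unfolding F_def r_matching_def cell_def by auto
    have "card (U T) \<le> (\<Sum>\<tau>\<in>T. card (set ` {y. set y \<subseteq> {1..N} \<and> map (block N J) y = \<tau>}))"
      unfolding U_def by (rule card_UN_le[OF finT])
    also have "\<dots> \<le> (\<Sum>\<tau>\<in>T. S ^ r)"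
    proof (rule sum_mono)
      fix \<tau> assume \<tau>: "\<tau> \<in> T"
      have "card (set ` {y. set y \<subseteq> {1..N} \<and> map (block N J) y = \<tau>})
        \<le> card {y. set y \<subseteq> {1..N} \<and> map (block N J) y = \<tau>}"
        by (rule card_image_le[OF conjunct1[OF one]])
      also have "\<dots> \<le> S ^ r" using one[of \<tau>] len[OF \<tau>] by simp
      finally show "card (set ` {y. set y \<subseteq> {1..N} \<and> map (block N J) y = \<tau>}) \<le> S ^ r" .
    qed
    also have "\<dots> = card T * S ^ r" by simp
    also have "card T \<le> D * k * 2 ^ (J * (r - 1))"
      using card_cells_le[OF _ r s k, where N = N and M = M and j = J] M unfolding F_def D_def by auto
    also have "D * k * 2 ^ (J * (r - 1)) \<le> D * n" using J by (simp add: mult.assoc)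
    finally have "card (U T) \<le> D * n * S ^ r" by simp
    moreover have "finite (U T)" unfolding U_def using finT one by blast
    ultimately show ?thesis by blast
  qed
  have sub: "F \<subseteq> (\<Union>T\<in>?T. {M. M \<subseteq> U T \<and> card M = n})"
  proof
    fix M assume M: "M \<in> F"
    then have rm: "r_matching r {1..r * n} M" unfolding F_def N_def by simp
    have "card M = n" using r_matching_card[OF rm] r by simp
    moreover have "M \<subseteq> U (cell N J ` M)"
    proof
      fix e assume e: "e \<in> M"
      then have "e \<subseteq> {1..N}" using rm unfolding r_matching_def N_def by blast
      then have "set (sorted_list_of_set e) = e" by (metis finite_atLeastAtMost finite_subset set_sorted_list_of_set)
      then show "e \<in> U (cell N J ` M)"
        unfolding U_def using e \<open>e \<subseteq> {1..N}\<close>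
        by (intro UN_I[of "cell N J e"] image_eqI[of _ _ "sorted_list_of_set e"]) (auto simp: cell_def)
    qed
    ultimately show "M \<in> (\<Union>T\<in>?T. {M. M \<subseteq> U T \<and> card M = n})" using M by blast
  qed
  have "card F \<le> card (\<Union>T\<in>?T. {M. M \<subseteq> U T \<and> card M = n})"
  proof (rule card_mono[OF _ sub])
    show "finite (\<Union>T\<in>?T. {M. M \<subseteq> U T \<and> card M = n})"
      using finF U by (intro finite_UN_I) auto
  qed
  also have "\<dots> \<le> (\<Sum>T\<in>?T. card {M. M \<subseteq> U T \<and> card M = n})"
    using finF by (intro card_UN_le) simp
  also have "\<dots> \<le> (\<Sum>T\<in>?T. (D * n * S ^ r) choose n)"
    using U by (intro sum_mono) (simp add: n_subsets binomial_right_mono)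
  also have "\<dots> = card ?T * ((D * n * S ^ r) choose n)" by simp
  also have "card ?T \<le> 2 ^ (1 + 2 ^ r * D * k * (\<Sum>i<J. 2 ^ (i * (r - 1))))"
    unfolding D_def by (rule card_cell_families[OF r s k F_def])
  also have "(2::nat) ^ (1 + 2 ^ r * D * k * (\<Sum>i<J. 2 ^ (i * (r - 1)))) \<le> 2 ^ (1 + 2 ^ r * D * n)"
  proof (rule power_increasing)
    have "k * (\<Sum>i<J. 2 ^ (i * (r - 1))) \<le> n"
      using sum_powers_le[OF r, of J] J by (meson le_trans mult_le_mono2)
    then show "1 + 2 ^ r * D * k * (\<Sum>i<J. 2 ^ (i * (r - 1))) \<le> 1 + 2 ^ r * D * n"
      by (simp add: mult.assoc)
  qed simp
  finally have "card F \<le> 2 ^ (1 + 2 ^ r * D * n) * ((D * n * S ^ r) choose n)" by simp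
  moreover have "num_matchings r (sign_pattern s r) (Suc k) n = card F"
    unfolding num_matchings_def F_def N_def by (simp add: less_Suc_eq_le)
  ultimately show ?thesis unfolding D_def S_def N_def by simp
qed

section \<open>The lower bound\<close>

text \<open>The members of \<open>\<Gamma>\<close> sort the keys \<open>\<kappa>\<close>, breaking ties in different ways. Each of the \<open>n!\<close>
  permutations turns \<open>\<kappa>\<close> into one of \<open>K ^ n\<close> words, so some word arises from at least \<open>n! / K ^ n\<close>
  of them, and composing these with one permutation that sorts the word gives \<open>\<Gamma>\<close>.\<close>

lemma card_sorting_permutations:
  fixes \<kappa> :: "nat \<Rightarrow> nat"
  assumes \<kappa>: "\<And>a. a < n \<Longrightarrow> \<kappa> a < K"
  shows "\<exists>w \<Gamma>. (\<forall>x y. x \<le> y \<longrightarrow> y < n \<longrightarrow> w x \<le> w y) \<and>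
    (\<forall>\<pi>\<in>\<Gamma>. \<pi> permutes {..<n} \<and> (\<forall>a<n. w (\<pi> a) = \<kappa> a)) \<and>
    fact n \<le> K ^ n * card \<Gamma>"
proof -
  define W where "W = {..<n} \<rightarrow>\<^sub>E {..<K}"
  define fib where "fib u = {\<pi>. \<pi> permutes {..<n} \<and> restrict (\<lambda>x. \<kappa> (inv \<pi> x)) {..<n} = u}" for u
  have finW: "finite W" unfolding W_def by (intro finite_PiE) auto
  have finP: "finite {\<pi>. \<pi> permutes {..<n}}" by (rule finite_permutations) simp
  have inW: "restrict (\<lambda>x. \<kappa> (inv \<pi> x)) {..<n} \<in> W" if "\<pi> permutes {..<n}" for \<pi>
  proof -
    have "inv \<pi> x < n" if "x < n" for x
      using permutes_in_image[OF permutes_inv[OF \<open>\<pi> permutes {..<n}\<close>], of x] that by simp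
    then show ?thesis unfolding W_def using \<kappa> by auto
  qed
  have neW: "W \<noteq> {}" using inW[OF permutes_id] by auto
  define B where "B = Max ((\<lambda>u. card (fib u)) ` W)"
  have "B \<in> (\<lambda>u. card (fib u)) ` W" unfolding B_def using finW neW by (intro Max_in) auto
  then obtain u where u: "u \<in> W" "card (fib u) = B" by blast
  have "fact n = card {\<pi>. \<pi> permutes {..<n}}" by (simp add: card_permutations)
  also have "\<dots> \<le> card (\<Union>u\<in>W. fib u)"
  proof (rule card_mono)
    show "finite (\<Union>u\<in>W. fib u)" by (rule finite_subset[OF _ finP]) (auto simp: fib_def)
    show "{\<pi>. \<pi> permutes {..<n}} \<subseteq> (\<Union>u\<in>W. fib u)" using inW unfolding fib_def by blast
  qed
  also have "\<dots> \<le> (\<Sum>u\<in>W. card (fib u))" by (rule card_UN_le[OF finW])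
  also have "\<dots> \<le> card W * B"
    using sum_bounded_above[of W "\<lambda>u. card (fib u)" B] finW unfolding B_def by auto
  also have "card W = K ^ n" unfolding W_def by (simp add: card_funcsetE)
  finally have large: "fact n \<le> K ^ n * card (fib u)" using u by simp
  define xs where "xs = map u [0..<n]"
  have "mset (sort xs) = mset xs" by simp
  then obtain \<sigma> where \<sigma>: "\<sigma> permutes {..<length xs}" "permute_list \<sigma> xs = sort xs"
    by (rule mset_eq_permutation)
  have \<sigma>n: "\<sigma> permutes {..<n}" using \<sigma>(1) unfolding xs_def by simp
  define w where "w x = u (\<sigma> x)" for x
  define \<Gamma> where "\<Gamma> = (\<lambda>\<pi>. inv \<sigma> \<circ> \<pi>) ` fib u"
  have wsort: "w x = sort xs ! x" if "x < n" for x
  proof -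
    have "\<sigma> x < n" using permutes_in_image[OF \<sigma>n, of x] that by simp
    then show ?thesis
      unfolding \<sigma>(2)[symmetric] w_def using that \<sigma>(1) by (simp add: permute_list_nth xs_def)
  qed
  have mono: "w x \<le> w y" if "x \<le> y" "y < n" for x y
    using that wsort sorted_nth_mono[of "sort xs" x y] by (simp add: xs_def)
  have \<Gamma>: "\<pi> permutes {..<n} \<and> (\<forall>a<n. w (\<pi> a) = \<kappa> a)" if "\<pi> \<in> \<Gamma>" for \<pi>
  proof -
    obtain \<rho> where \<rho>: "\<pi> = inv \<sigma> \<circ> \<rho>" "\<rho> permutes {..<n}" "restrict (\<lambda>x. \<kappa> (inv \<rho> x)) {..<n} = u"
      using \<open>\<pi> \<in> \<Gamma>\<close> unfolding \<Gamma>_def fib_def by auto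
    have "w (\<pi> a) = \<kappa> a" if "a < n" for a
    proof -
      have "\<rho> a < n" using permutes_in_image[OF \<rho>(2), of a] that by simp
      have "w (\<pi> a) = u (\<rho> a)"
        unfolding w_def \<rho>(1) by (simp add: permutes_inverses(1)[OF \<sigma>n])
      also have "u (\<rho> a) = \<kappa> a"
        using \<open>\<rho> a < n\<close> unfolding \<rho>(3)[symmetric] by (simp add: permutes_inverses(2)[OF \<rho>(2)])
      finally show ?thesis .
    qed
    moreover have "\<pi> permutes {..<n}" unfolding \<rho>(1) by (rule permutes_compose[OF \<rho>(2) permutes_inv[OF \<sigma>n]])
    ultimately show ?thesis by blast
  qed
  have "inj_on (\<lambda>\<pi>. inv \<sigma> \<circ> \<pi>) (fib u)"
  proof (rule inj_onI)
    fix \<pi> \<rho> assume eq: "inv \<sigma> \<circ> \<pi> = inv \<sigma> \<circ> \<rho>"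
    show "\<pi> = \<rho>"
    proof
      fix x
      have "inv \<sigma> (\<pi> x) = inv \<sigma> (\<rho> x)" using fun_cong[OF eq, of x] by simp
      then have "\<sigma> (inv \<sigma> (\<pi> x)) = \<sigma> (inv \<sigma> (\<rho> x))" by (rule arg_cong)
      then show "\<pi> x = \<rho> x" by (simp only: permutes_inverses(1)[OF \<sigma>n])
    qed
  qed
  then have "card \<Gamma> = card (fib u)" unfolding \<Gamma>_def by (rule card_image)
  then have "fact n \<le> K ^ n * card \<Gamma>" using large by simp
  moreover have "\<forall>x y. x \<le> y \<longrightarrow> y < n \<longrightarrow> w x \<le> w y" using mono by simp
  moreover have "\<forall>\<pi>\<in>\<Gamma>. \<pi> permutes {..<n} \<and> (\<forall>a<n. w (\<pi> a) = \<kappa> a)" using \<Gamma> by (intro ballI)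
  ultimately show ?thesis by (intro exI conjI)
qed

text \<open>The first \<open>r - 1\<close> coordinates are arbitrary below \<open>L\<close> and the last is chosen to give the sum
  \<open>(r - 1) * L + t\<close> with \<open>t < k\<close>.\<close>

lemma layered_vectors:
  assumes r: "2 \<le> r" and n: "n \<le> L ^ (r - 1) * k"
  shows "\<exists>c :: nat \<Rightarrow> nat \<Rightarrow> nat. (\<forall>a<n. \<forall>i<r. c i a < (r - 1) * L + k) \<and>
    (\<forall>a<n. (\<Sum>i<r. c i a) \<in> {(r - 1) * L..<(r - 1) * L + k}) \<and>
    (\<forall>a<n. \<forall>b<n. (\<forall>i<r. c i a = c i b) \<longrightarrow> a = b)"
proof -
  define D where "D = ({..<r - 1} \<rightarrow>\<^sub>E {..<L}) \<times> {..<k}"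
  have finD: "finite D" unfolding D_def by (intro finite_cartesian_product finite_PiE finite_lessThan)
  have "card D = L ^ (r - 1) * k" unfolding D_def by (simp add: card_cartesian_product card_funcsetE)
  then have "card {..<n} \<le> card D" using n by simp
  then obtain h where h: "h ` {..<n} \<subseteq> D" "inj_on h {..<n}"
    using card_le_inj[OF finite_lessThan finD] by blast
  define c where "c i a = (if i < r - 1 then fst (h a) i
    else (r - 1) * L + snd (h a) - (\<Sum>i<r - 1. fst (h a) i))" for i a
  have hD: "fst (h a) \<in> {..<r - 1} \<rightarrow>\<^sub>E {..<L}" "snd (h a) < k" if "a < n" for a
  proof -
    have "h a \<in> D" using h(1) that by (meson image_subset_iff lessThan_iff)
    then show "fst (h a) \<in> {..<r - 1} \<rightarrow>\<^sub>E {..<L}" "snd (h a) < k"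
      unfolding D_def mem_Times_iff by simp_all
  qed
  have low: "fst (h a) i < L" if "a < n" "i < r - 1" for a i
    using hD(1)[OF that(1)] that(2) by auto
  have sumle: "(\<Sum>i<r - 1. fst (h a) i) \<le> (r - 1) * L" if "a < n" for a
    using sum_bounded_above[of "{..<r - 1}" "fst (h a)" L] low[OF that] by (simp add: less_imp_le)
  have sum: "(\<Sum>i<r. c i a) = (r - 1) * L + snd (h a)" if "a < n" for a
  proof -
    have "(\<Sum>i<r. c i a) = (\<Sum>i<Suc (r - 1). c i a)" using r by simp
    also have "\<dots> = (\<Sum>i<r - 1. fst (h a) i) + ((r - 1) * L + snd (h a) - (\<Sum>i<r - 1. fst (h a) i))"
      by (simp add: c_def)
    also have "\<dots> = (r - 1) * L + snd (h a)" using sumle[OF that] by simp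
    finally show ?thesis .
  qed
  have "c i a < (r - 1) * L + k" if "a < n" "i < r" for a i
  proof (cases "i < r - 1")
    case True
    have "c i a < L" using low[OF that(1) True] True unfolding c_def by simp
    also have "L \<le> (r - 1) * L + k" using mult_le_mono1[of 1 "r - 1" L] r by linarith
    finally show ?thesis .
  next
    case False
    then show ?thesis using hD(2)[OF that(1)] unfolding c_def by simp
  qed
  moreover have "a = b" if ab: "a < n" "b < n" "\<forall>i<r. c i a = c i b" for a b
  proof -
    have "fst (h a) = fst (h b)"
    proof (rule PiE_ext[OF hD(1)[OF ab(1)] hD(1)[OF ab(2)]])
      fix i assume "i \<in> {..<r - 1}"
      then show "fst (h a) i = fst (h b) i" using ab(3)[rule_format, of i] unfolding c_def by simp
    qed
    moreover have "snd (h a) = snd (h b)"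
    proof -
      have "(\<Sum>i<r. c i a) = (\<Sum>i<r. c i b)" using ab(3) by simp
      then show ?thesis using sum[OF ab(1)] sum[OF ab(2)] by simp
    qed
    ultimately have "h a = h b" by (simp add: prod_eq_iff)
    then show "a = b" using h(2) ab by (auto dest: inj_onD)
  qed
  ultimately show ?thesis using sum hD(2) by (intro exI[of _ c]) auto
qed

definition vertex :: "nat \<Rightarrow> nat \<Rightarrow> nat \<Rightarrow> nat" where
  "vertex n i x = i * n + 1 + x"

definition tuple_edge :: "nat \<Rightarrow> nat \<Rightarrow> (nat \<Rightarrow> nat \<Rightarrow> nat) \<Rightarrow> nat \<Rightarrow> nat set" where
  "tuple_edge r n \<pi> a = (\<lambda>i. vertex n i (\<pi> i a)) ` {..<r}"

text \<open>The \<open>r\<close>-partite matching in which the edge \<open>a\<close> has the vertex number \<open>\<pi> i a\<close> of the interval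
  \<open>i\<close>, both counted from 0.\<close>

definition tuple_matching :: "nat \<Rightarrow> nat \<Rightarrow> (nat \<Rightarrow> nat \<Rightarrow> nat) \<Rightarrow> nat set set" where
  "tuple_matching r n \<pi> = tuple_edge r n \<pi> ` {..<n}"

lemma vertex_eq_iff:
  assumes "x < n" "y < n"
  shows "vertex n i x = vertex n j y \<longleftrightarrow> i = j \<and> x = y"
proof
  assume "vertex n i x = vertex n j y"
  then have eq: "i * n + x = j * n + y" unfolding vertex_def by simp
  have "i = (i * n + x) div n" using assms by simp
  also have "\<dots> = j" unfolding eq using assms by simp
  finally show "i = j \<and> x = y" using eq by simp
qed simp

lemma tuple_edge_eq:
  assumes "\<And>i. i < r \<Longrightarrow> \<pi> i a < n" "\<And>i. i < r \<Longrightarrow> \<rho> i b < n"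
    and "tuple_edge r n \<pi> a = tuple_edge r n \<rho> b" "i < r"
  shows "\<pi> i a = \<rho> i b"
proof -
  have "vertex n i (\<pi> i a) \<in> tuple_edge r n \<rho> b"
    using assms(3,4) unfolding tuple_edge_def by blast
  then show ?thesis using assms vertex_eq_iff unfolding tuple_edge_def by auto
qed

lemma r_matching_tuple_matching:
  assumes "\<And>i. i < r \<Longrightarrow> \<pi> i permutes {..<n}"
  shows "r_matching r {1..r * n} (tuple_matching r n \<pi>)"
proof -
  have lt: "\<pi> i a < n \<longleftrightarrow> a < n" if "i < r" for i a
    using permutes_in_image[OF assms[OF that], of a] by simp
  have sub: "tuple_edge r n \<pi> a \<subseteq> {1..r * n}" "card (tuple_edge r n \<pi> a) = r" if "a < n" for a
  proof -
    have "vertex n i (\<pi> i a) \<in> {1..r * n}" if i: "i < r" for i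
    proof -
      have "vertex n i (\<pi> i a) \<le> i * n + n" using lt[OF i, of a] \<open>a < n\<close> unfolding vertex_def by simp
      also have "\<dots> = Suc i * n" by simp
      also have "\<dots> \<le> r * n" using i by (intro mult_right_mono) auto
      finally show ?thesis unfolding vertex_def by simp
    qed
    then show "tuple_edge r n \<pi> a \<subseteq> {1..r * n}" unfolding tuple_edge_def by blast
    have "inj_on (\<lambda>i. vertex n i (\<pi> i a)) {..<r}"
      using lt \<open>a < n\<close> by (auto simp: inj_on_def vertex_eq_iff)
    then show "card (tuple_edge r n \<pi> a) = r" unfolding tuple_edge_def by (simp add: card_image)
  qed
  have "\<exists>!e. e \<in> tuple_matching r n \<pi> \<and> v \<in> e" if v: "v \<in> {1..r * n}" for v
  proof -
    have n: "0 < n" using v by (cases n) auto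
    define i where "i = (v - 1) div n"
    define x where "x = (v - 1) mod n"
    have i: "i < r" unfolding i_def using v by (intro less_mult_imp_div_less) auto
    have x: "x < n" unfolding x_def using n by simp
    have vv: "v = vertex n i x" unfolding vertex_def i_def x_def using v by simp
    define a where "a = inv (\<pi> i) x"
    have \<pi>a: "\<pi> i a = x" unfolding a_def by (simp add: permutes_inverses(1)[OF assms[OF i]])
    then have a: "a < n" using lt[OF i, of a] x by simp
    show ?thesis
    proof (rule ex1I[of _ "tuple_edge r n \<pi> a"])
      show "tuple_edge r n \<pi> a \<in> tuple_matching r n \<pi> \<and> v \<in> tuple_edge r n \<pi> a"
        unfolding tuple_matching_def tuple_edge_def using a i vv \<pi>a by auto
      fix e assume "e \<in> tuple_matching r n \<pi> \<and> v \<in> e"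
      then obtain b j where b: "b < n" "e = tuple_edge r n \<pi> b" "j < r" "v = vertex n j (\<pi> j b)"
        unfolding tuple_matching_def tuple_edge_def by auto
      then have "i = j" "x = \<pi> j b"
        using vertex_eq_iff[of x n "\<pi> j b" i j] x lt[of j b] vv by auto
      then have "b = a" using \<pi>a permutes_inj[OF assms[OF i]] by (auto dest: injD)
      then show "e = tuple_edge r n \<pi> a" using b by simp
    qed
  qed
  then show ?thesis unfolding r_matching_def tuple_matching_def using sub by auto
qed

text \<open>The permutation \<open>\<pi> i\<close> sorts the edges by their coordinate \<open>c i\<close>, in reverse order where the
  sign is negative. The matching determines the permutations: a position in the interval \<open>i\<close>
  determines the key that the sorted word has there, hence all coordinates of an edge can be read off, and they identify
  its index. Along a clique all coordinates \<open>c i\<close> move weakly in the same direction, so the sums are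
  distinct; they take only \<open>k\<close> values.\<close>

lemma num_matchings_lower:
  assumes r: "2 \<le> r" and s: "\<And>i. s i = 1 \<or> s i = (-1::int)" and k: "1 \<le> k"
    and n: "n \<le> L ^ (r - 1) * k"
  shows "fact n ^ r \<le> (((r - 1) * L + k) ^ n) ^ r * num_matchings r (sign_pattern s r) (Suc k) n"
proof -
  define K where "K = (r - 1) * L + k"
  obtain c :: "nat \<Rightarrow> nat \<Rightarrow> nat" where cK: "\<And>a i. a < n \<Longrightarrow> i < r \<Longrightarrow> c i a < K"
    and csum: "\<And>a. a < n \<Longrightarrow> (\<Sum>i<r. c i a) \<in> {(r - 1) * L..<(r - 1) * L + k}"
    and cinj: "\<And>a b. a < n \<Longrightarrow> b < n \<Longrightarrow> (\<And>i. i < r \<Longrightarrow> c i a = c i b) \<Longrightarrow> a = b"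
    using layered_vectors[OF r n] unfolding K_def by blast
  define key where "key i a = (if s i = 1 then c i a else K - 1 - c i a)" for i a
  have "\<forall>i. \<exists>w \<Gamma>. i < r \<longrightarrow> (\<forall>x y. x \<le> y \<longrightarrow> y < n \<longrightarrow> w x \<le> w y) \<and>
    (\<forall>\<pi>\<in>\<Gamma>. \<pi> permutes {..<n} \<and> (\<forall>a<n. w (\<pi> a) = key i a)) \<and> fact n \<le> K ^ n * card \<Gamma>"
  proof
    fix i
    show "\<exists>w \<Gamma>. i < r \<longrightarrow> (\<forall>x y. x \<le> y \<longrightarrow> y < n \<longrightarrow> w x \<le> w y) \<and>
      (\<forall>\<pi>\<in>\<Gamma>. \<pi> permutes {..<n} \<and> (\<forall>a<n. w (\<pi> a) = key i a)) \<and> fact n \<le> K ^ n * card \<Gamma>"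
    proof (cases "i < r")
      case True
      have "key i a < K" if "a < n" for a using cK[OF that True] unfolding key_def by auto
      from card_sorting_permutations[of n "key i" K, OF this] show ?thesis using True by (simp only: simp_thms)
    qed simp
  qed
  then obtain w \<Gamma> where w: "\<And>i x y. i < r \<Longrightarrow> x \<le> y \<Longrightarrow> y < n \<Longrightarrow> (w i x :: nat) \<le> w i y"
    and \<Gamma>: "\<And>i \<pi>. i < r \<Longrightarrow> \<pi> \<in> \<Gamma> i \<Longrightarrow> \<pi> permutes {..<n} \<and> (\<forall>a<n. w i (\<pi> a) = key i a)"
    and card\<Gamma>: "\<And>i. i < r \<Longrightarrow> fact n \<le> K ^ n * card (\<Gamma> i)"
    by metis
  define T where "T = Pi\<^sub>E {..<r} \<Gamma>"
  have T: "\<pi> i permutes {..<n}" "\<And>a. a < n \<Longrightarrow> w i (\<pi> i a) = key i a" if "\<pi> \<in> T" "i < r" for \<pi> i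
  proof -
    have "\<pi> i \<in> \<Gamma> i" using that unfolding T_def by auto
    from \<Gamma>[OF that(2) this] show "\<pi> i permutes {..<n}" "\<And>a. a < n \<Longrightarrow> w i (\<pi> i a) = key i a" by auto
  qed
  have Tlt: "\<pi> i a < n" if "\<pi> \<in> T" "i < r" "a < n" for \<pi> i a
    using permutes_in_image[OF T(1)[OF that(1,2)], of a] that(3) by simp
  have key_c: "c i a = c i b" if "key i a = key i b" "a < n" "b < n" "i < r" for i a b
    using that cK[of a i] cK[of b i] unfolding key_def by (auto split: if_splits)
  have inj: "inj_on (tuple_matching r n) T"
  proof (rule inj_onI)
    fix \<pi> \<rho> assume \<pi>: "\<pi> \<in> T" and \<rho>: "\<rho> \<in> T" and eq: "tuple_matching r n \<pi> = tuple_matching r n \<rho>"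
    have "\<pi> i a = \<rho> i a" if a: "a < n" and i: "i < r" for i a
    proof -
      have "tuple_edge r n \<pi> a \<in> tuple_matching r n \<pi>"
        using a unfolding tuple_matching_def by blast
      then have "tuple_edge r n \<pi> a \<in> tuple_matching r n \<rho>" by (simp only: eq)
      then obtain b where b: "b < n" "tuple_edge r n \<pi> a = tuple_edge r n \<rho> b"
        unfolding tuple_matching_def by blast
      have eqb: "\<pi> j a = \<rho> j b" if "j < r" for j
        using Tlt \<pi> \<rho> a b(1) that by (intro tuple_edge_eq[OF _ _ b(2)]) auto
      have "a = b"
      proof (rule cinj[OF a b(1)])
        fix j assume j: "j < r"
        have "key j a = key j b" using T(2)[OF \<pi> j a] T(2)[OF \<rho> j b(1)] eqb[OF j] by simp
        then show "c j a = c j b" using key_c a b(1) j by blast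
      qed
      then show ?thesis using eqb[OF i] by simp
    qed
    then have "\<pi> i = \<rho> i" if "i < r" for i
      using T(1)[OF \<pi> that] T(1)[OF \<rho> that] that unfolding permutes_def
      by (intro ext) (metis lessThan_iff)
    then show "\<pi> = \<rho>" using \<pi> \<rho> unfolding T_def by (intro PiE_ext[of \<pi> _ _ \<rho>]) auto
  qed
  have small: "max_clique_size (sign_pattern s r) (tuple_matching r n \<pi>) < Suc k" if \<pi>: "\<pi> \<in> T" for \<pi>
  proof -
    have "finite (tuple_matching r n \<pi>)" unfolding tuple_matching_def by simp
    then obtain Q where Q: "Q \<subseteq> tuple_matching r n \<pi>" "is_clique (sign_pattern s r) Q"
      "card Q = max_clique_size (sign_pattern s r) (tuple_matching r n \<pi>)"
      by (rule max_clique_size_attained)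
    define I where "I = {a. a < n \<and> tuple_edge r n \<pi> a \<in> Q}"
    define tot where "tot a = (\<Sum>i<r. c i a)" for a
    have finI: "finite I" unfolding I_def by simp
    have less: "tot a < tot b"
      if ab: "a < n" "b < n" "a \<noteq> b" and sg: "\<forall>i<r. s i = 1 \<longleftrightarrow> \<pi> i a < \<pi> i b" for a b
    proof -
      have le: "c i a \<le> c i b" if i: "i < r" for i
      proof (cases "s i = 1")
        case True
        then have "\<pi> i a \<le> \<pi> i b" using sg i by auto
        then have "key i a \<le> key i b"
          using w[OF i _ Tlt[OF \<pi> i ab(2)]] T(2)[OF \<pi> i ab(1)] T(2)[OF \<pi> i ab(2)] by metis
        then show ?thesis using True unfolding key_def by simp
      next
        case False
        then have "\<pi> i b \<le> \<pi> i a" using sg i by auto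
        then have "key i b \<le> key i a"
          using w[OF i _ Tlt[OF \<pi> i ab(1)]] T(2)[OF \<pi> i ab(1)] T(2)[OF \<pi> i ab(2)] by metis
        then show ?thesis using False cK[OF ab(1) i] cK[OF ab(2) i] unfolding key_def by simp
      qed
      moreover have "\<exists>i<r. c i a \<noteq> c i b" using cinj[OF ab(1,2)] ab(3) by blast
      ultimately show ?thesis unfolding tot_def
        by (intro sum_strict_mono_ex1) (auto simp: le_less)
    qed
    have "inj_on tot I"
    proof (rule inj_onI, rule ccontr)
      fix a b assume a: "a \<in> I" and b: "b \<in> I" and eq: "tot a = tot b" and ne: "a \<noteq> b"
      have ab: "a < n" "b < n" using a b unfolding I_def by auto
      have ne': "\<pi> i a \<noteq> \<pi> i b" if "i < r" for i
        using permutes_inj[OF T(1)[OF \<pi> that]] ne by (auto dest: injD)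
      have "tuple_edge r n \<pi> a \<noteq> tuple_edge r n \<pi> b"
        using tuple_edge_eq[of r \<pi> a n \<pi> b 0] Tlt[OF \<pi>] ab ne'[of 0] r by auto
      then have "order_isomorphic {tuple_edge r n \<pi> a, tuple_edge r n \<pi> b} (sign_pattern s r)"
        using Q(2) a b unfolding is_clique_def I_def by blast
      then have "(\<forall>i<r. s i = 1 \<longleftrightarrow> vertex n i (\<pi> i a) < vertex n i (\<pi> i b)) \<or>
        (\<forall>i<r. s i = 1 \<longleftrightarrow> vertex n i (\<pi> i b) < vertex n i (\<pi> i a))"
        unfolding tuple_edge_def
      proof (rule sign_pattern_of_order_isomorphic)
        fix i assume i: "Suc i < r"
        show "max (vertex n i (\<pi> i a)) (vertex n i (\<pi> i b))
          < min (vertex n (Suc i) (\<pi> (Suc i) a)) (vertex n (Suc i) (\<pi> (Suc i) b))"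
          using Tlt[OF \<pi>, of i a] Tlt[OF \<pi>, of i b] ab i unfolding vertex_def by auto
      next
        fix i assume "i < r"
        then show "vertex n i (\<pi> i a) \<noteq> vertex n i (\<pi> i b)" using ne' unfolding vertex_def by simp
      qed
      then have "(\<forall>i<r. s i = 1 \<longleftrightarrow> \<pi> i a < \<pi> i b) \<or> (\<forall>i<r. s i = 1 \<longleftrightarrow> \<pi> i b < \<pi> i a)"
        unfolding vertex_def by simp
      then show False using less[OF ab ne] less[OF ab(2,1)] ne eq by auto
    qed
    then have "card I = card (tot ` I)" by (simp add: card_image)
    also have "\<dots> \<le> card {(r - 1) * L..<(r - 1) * L + k}"
      using csum unfolding I_def tot_def by (intro card_mono) auto
    finally have "card I \<le> k" by simp
    moreover have "Q \<subseteq> tuple_edge r n \<pi> ` I" using Q(1) unfolding tuple_matching_def I_def by blast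
    then have "card Q \<le> card I" using finI by (meson card_image_le card_mono finite_imageI le_trans)
    ultimately show ?thesis using Q(3) by simp
  qed
  have "card T \<le> num_matchings r (sign_pattern s r) (Suc k) n"
    unfolding num_matchings_def
  proof (rule card_inj_on_le[OF inj])
    show "tuple_matching r n ` T \<subseteq> {M. r_matching r {1..r * n} M \<and> max_clique_size (sign_pattern s r) M < Suc k}"
      using r_matching_tuple_matching T(1) small by blast
    show "finite {M. r_matching r {1..r * n} M \<and> max_clique_size (sign_pattern s r) M < Suc k}"
      by (rule finite_subset[of _ "Pow (Pow {1..r * n})"]) (auto simp: r_matching_def)
  qed
  moreover have "fact n ^ r \<le> (K ^ n) ^ r * card T"
  proof -
    have "fact n ^ r = (\<Prod>i<r. (fact n :: nat))" by simp
    also have "\<dots> \<le> (\<Prod>i<r. K ^ n * card (\<Gamma> i))" using card\<Gamma> by (intro prod_mono) auto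
    also have "\<dots> = (K ^ n) ^ r * card T" unfolding T_def by (simp add: prod.distrib card_PiE)
    finally show ?thesis .
  qed
  ultimately show ?thesis unfolding K_def by (meson le_trans mult_le_mono2)
qed

section \<open>Asymptotics\<close>

lemma power_le_exp_mult_fact: "real n ^ n \<le> exp (real n) * fact n"
proof -
  have s: "summable (\<lambda>k. real n ^ k /\<^sub>R fact k)" by (rule summable_exp_generic)
  have "sum (\<lambda>k. real n ^ k /\<^sub>R fact k) {n} \<le> (\<Sum>k. real n ^ k /\<^sub>R fact k)"
    by (rule sum_le_suminf[OF s]) auto
  then have "real n ^ n / fact n \<le> exp (real n)" unfolding exp_def by (simp add: field_simps)
  then show ?thesis by (simp add: field_simps)
qed

lemma binomial_le_exp_power:
  assumes "1 \<le> n"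
  shows "real ((n * x) choose n) \<le> (exp 1 * real x) ^ n"
proof -
  have "real ((n * x) choose n) * fact n \<le> real (n * x) ^ n"
    using binomial_fact_pow[of "n * x" n] by (metis of_nat_fact of_nat_le_iff of_nat_mult of_nat_power)
  also have "\<dots> = real n ^ n * real x ^ n" by (simp add: power_mult_distrib)
  also have "\<dots> \<le> exp (real n) * fact n * real x ^ n"
    by (intro mult_right_mono power_le_exp_mult_fact) simp
  also have "\<dots> = (exp 1 * real x) ^ n * fact n"
    by (simp add: power_mult_distrib flip: exp_of_nat_mult)
  finally show ?thesis by simp
qed

lemma growth_rate_eq:
  fixes r n k :: nat
  assumes r: "2 \<le> r" and n: "1 \<le> n" and k: "1 \<le> k"
    and Q: "Q = (real n / real k) powr (1 / (real r - 1))"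
  shows "real k powr ((real r / (real r - 1)) * real n) *
      real n powr ((real r - 1 - 1 / (real r - 1)) * real n) = (real n / Q) ^ (r * n)"
proof -
  have pos: "0 < real n" "0 < real k" "0 < Q" "0 < real n / Q" unfolding Q using n k by auto
  have r1: "real r - 1 \<noteq> 0" using r by auto
  have lnQ: "ln Q = (ln (real n) - ln (real k)) / (real r - 1)"
    unfolding Q using pos by (simp add: ln_powr ln_div)
  have "(real n / Q) ^ (r * n) = exp (real (r * n) * ln (real n / Q))"
    using pos by (subst powr_realpow[symmetric]) (auto simp: powr_def)
  also have "ln (real n / Q) = ln (real n) - (ln (real n) - ln (real k)) / (real r - 1)"
    using pos by (simp add: ln_div lnQ)
  also have "real (r * n) * \<dots> = (real r / (real r - 1)) * real n * ln (real k) +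
      (real r - 1 - 1 / (real r - 1)) * real n * ln (real n)"
  proof -
    define \<rho> where "\<rho> = real r - 1"
    have "real r = \<rho> + 1" "\<rho> \<noteq> 0" unfolding \<rho>_def using r1 by auto
    then show ?thesis by (simp add: field_simps)
  qed
  also have "exp \<dots> = real k powr ((real r / (real r - 1)) * real n) *
      real n powr ((real r - 1 - 1 / (real r - 1)) * real n)"
    using pos by (simp add: powr_def exp_add)
  finally show ?thesis by simp
qed

lemma scale_properties:
  fixes r n k :: nat
  assumes r: "2 \<le> r" and n: "1 \<le> n" and k: "1 \<le> k" and kn: "k ^ r \<le> n"
    and Q: "Q = (real n / real k) powr (1 / (real r - 1))"
  shows "1 \<le> Q" "Q \<le> real n" "real k \<le> Q" "real k * Q ^ (r - 1) = real n"
proof -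
  have "k ^ 1 \<le> k ^ r" using k r by (intro power_increasing) auto
  then have "k \<le> n" using kn by simp
  then have ratio: "1 \<le> real n / real k" using k by simp
  have r1: "1 \<le> real r - 1" using r by simp
  show "1 \<le> Q" unfolding Q using ratio r1 by (intro ge_one_powr_ge_zero) auto
  have "Q \<le> (real n / real k) powr 1" unfolding Q using ratio r1 by (intro powr_mono) auto
  also have "\<dots> = real n / real k" using ratio by simp
  also have "\<dots> \<le> real n" using frac_le[of "real n" "real n" 1 "real k"] k by simp
  finally show "Q \<le> real n" .
  have pos: "0 < Q" using \<open>1 \<le> Q\<close> by simp
  have "Q ^ (r - 1) = Q powr (real r - 1)" using pos r by (simp add: powr_realpow[symmetric] of_nat_diff)
  also have "\<dots> = real n / real k" unfolding Q powr_powr using r1 ratio by simp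
  finally have Qpow: "Q ^ (r - 1) = real n / real k" .
  then show "real k * Q ^ (r - 1) = real n" using k by simp
  have "real k * real k ^ (r - 1) = real (k ^ r)" using r by (cases r) auto
  also have "\<dots> \<le> real n" using kn by (simp only: of_nat_le_iff)
  finally have "real k ^ (r - 1) \<le> Q ^ (r - 1)" unfolding Qpow using k by (simp add: field_simps)
  then show "real k \<le> Q" using pos r by (subst (asm) power_mono_iff) auto
qed

text \<open>The choice \<open>L = \<lceil>Q\<rceil>\<close> makes \<open>L ^ (r - 1) * k\<close> at least \<open>n\<close>. As \<open>k \<le> Q\<close>, a consequence of
  \<open>k ^ r \<le> n\<close>, the number of keys is \<open>O(Q)\<close>.\<close>

lemma lower_estimate:
  fixes r n k :: nat and N :: nat
  assumes r: "2 \<le> r" and n: "1 \<le> n" and k: "1 \<le> k" and kn: "k ^ r \<le> n"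
    and Q: "Q = (real n / real k) powr (1 / (real r - 1))"
    and count: "\<And>L. n \<le> L ^ (r - 1) * k \<Longrightarrow> fact n ^ r \<le> (((r - 1) * L + k) ^ n) ^ r * N"
  shows "(real n / Q) ^ (r * n) \<le> ((2 * exp 1 * real r) ^ r) ^ n * real N"
proof -
  note sc = scale_properties[OF r n k kn Q]
  define L where "L = nat \<lceil>Q\<rceil>"
  have L: "Q \<le> real L" "real L \<le> 2 * Q"
    using sc(1) unfolding L_def by linarith+
  have "real n \<le> real (L ^ (r - 1) * k)"
  proof -
    have "real n = Q ^ (r - 1) * real k" using sc(4) by (simp add: mult.commute)
    also have "\<dots> \<le> real L ^ (r - 1) * real k" using L sc(1) by (intro mult_right_mono power_mono) auto
    finally show ?thesis by simp
  qed
  then have nL: "n \<le> L ^ (r - 1) * k" by (simp only: of_nat_le_iff)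
  define K where "K = (r - 1) * L + k"
  have K: "real K \<le> 2 * real r * Q"
  proof -
    have "real K = (real r - 1) * real L + real k" unfolding K_def using r by (simp add: of_nat_diff)
    also have "\<dots> \<le> (real r - 1) * (2 * Q) + Q"
      using r L sc by (intro add_mono mult_left_mono) auto
    also have "\<dots> \<le> 2 * real r * Q" using sc(1) by (simp add: algebra_simps)
    finally show ?thesis .
  qed
  have count': "(fact n :: real) ^ r \<le> (real K ^ n) ^ r * real N"
  proof -
    have "real (fact n ^ r) \<le> real ((K ^ n) ^ r * N)"
      using count[OF nL] unfolding K_def by (simp only: of_nat_le_iff)
    then show ?thesis by simp
  qed
  have "real n ^ (r * n) = (real n ^ n) ^ r" by (simp add: mult.commute flip: power_mult)
  also have "\<dots> \<le> (exp (real n) * fact n) ^ r" by (intro power_mono power_le_exp_mult_fact) simp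
  also have "\<dots> = exp 1 ^ (n * r) * fact n ^ r"
    by (simp add: power_mult_distrib power_mult flip: exp_of_nat_mult)
  also have "\<dots> \<le> exp 1 ^ (n * r) * ((real K ^ n) ^ r * real N)"
    by (intro mult_left_mono count') simp
  also have "\<dots> \<le> exp 1 ^ (n * r) * (((2 * real r * Q) ^ n) ^ r * real N)"
    using K by (intro mult_left_mono mult_right_mono power_mono) auto
  also have "\<dots> = Q ^ (r * n) * (((2 * exp 1 * real r) ^ r) ^ n * real N)"
    by (simp add: power_mult_distrib mult_ac flip: power_mult)
  finally show ?thesis using sc(1) by (simp add: power_divide field_simps)
qed

text \<open>The scale \<open>J\<close> is the largest with \<open>2 ^ J \<le> Q\<close>, so that there are \<open>O(n)\<close> occupied cells and the
  blocks have \<open>O(n / Q)\<close> vertices.\<close>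

lemma upper_estimate:
  fixes r n k :: nat and N :: nat
  assumes r: "2 \<le> r" and n: "1 \<le> n" and k: "1 \<le> k" and kn: "k ^ r \<le> n"
    and Q: "Q = (real n / real k) powr (1 / (real r - 1))"
    and count: "\<And>J. k * 2 ^ (J * (r - 1)) \<le> n \<Longrightarrow> N \<le> 2 ^ (1 + 2 ^ r * D * n) *
      ((D * n * (r * n div 2 ^ J + 1) ^ r) choose n)"
  shows "real N \<le> (2 ^ (1 + 2 ^ r * D) * (exp 1 * real D * (4 * real r) ^ r)) ^ n * (real n / Q) ^ (r * n)"
proof -
  note sc = scale_properties[OF r n k kn Q]
  obtain J where J: "2 ^ J \<le> Q" "Q < 2 * 2 ^ J"
  proof -
    have "\<exists>i. Q < 2 ^ i" by (rule real_arch_pow) simp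
    define i where "i = (LEAST i. Q < 2 ^ i)"
    have i: "Q < 2 ^ i" unfolding i_def using \<open>\<exists>i. Q < 2 ^ i\<close> by (rule LeastI_ex)
    have "i \<noteq> 0" using i sc(1) by (intro notI) simp
    then obtain j where j: "i = Suc j" by (cases i) auto
    have "\<not> Q < 2 ^ j" using not_less_Least[of j "\<lambda>i. Q < 2 ^ i"] j unfolding i_def by simp
    then show thesis using that[of j] i j by simp
  qed
  have "real (k * 2 ^ (J * (r - 1))) = real k * (2 ^ J) ^ (r - 1)" by (simp add: power_mult)
  also have "\<dots> \<le> real k * Q ^ (r - 1)" using J(1) by (intro mult_left_mono power_mono) auto
  finally have "real (k * 2 ^ (J * (r - 1))) \<le> real n" using sc(4) by simp
  then have kJ: "k * 2 ^ (J * (r - 1)) \<le> n" by (simp only: of_nat_le_iff)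
  define S where "S = r * n div 2 ^ J + 1"
  have S: "real S \<le> 4 * real r * (real n / Q)"
  proof -
    have rn: "Q \<le> real r * real n" using sc(2) r mult_mono[of 1 "real r" "real n" "real n"] by simp
    have "real (r * n div 2 ^ J) \<le> real (r * n) / real (2 ^ J)" by (rule of_nat_div_le_of_nat)
    then have "real S \<le> real r * real n / 2 ^ J + 1" unfolding S_def by simp
    also have "\<dots> \<le> real r * real n / 2 ^ J + real r * real n / 2 ^ J"
    proof (rule add_left_mono)
      show "1 \<le> real r * real n / 2 ^ J" using rn J(1) by simp
    qed
    also have "\<dots> = 2 * (real r * real n) * (1 / 2 ^ J)" by simp
    also have "\<dots> \<le> 2 * (real r * real n) * (2 / Q)"
      using J(2) sc(1) by (intro mult_left_mono) (auto simp: field_simps)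
    finally show ?thesis by (simp add: mult_ac)
  qed
  have "real N \<le> real (2 ^ (1 + 2 ^ r * D * n) * ((D * n * S ^ r) choose n))"
    using count[OF kJ] unfolding S_def by (simp only: of_nat_le_iff)
  also have "\<dots> = 2 ^ (1 + 2 ^ r * D * n) * real ((n * (D * S ^ r)) choose n)" by (simp add: mult_ac)
  also have "\<dots> \<le> 2 ^ ((1 + 2 ^ r * D) * n) * (exp 1 * real (D * S ^ r)) ^ n"
    using n by (intro mult_mono power_increasing binomial_le_exp_power) (auto simp: add_mult_distrib)
  also have "\<dots> = 2 ^ ((1 + 2 ^ r * D) * n) * (exp 1 * (real D * real S ^ r)) ^ n" by simp
  also have "\<dots> \<le> 2 ^ ((1 + 2 ^ r * D) * n) * (exp 1 * (real D * (4 * real r * (real n / Q)) ^ r)) ^ n"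
    using S by (intro mult_left_mono power_mono) auto
  also have "\<dots> = (2 ^ (1 + 2 ^ r * D) * (exp 1 * real D * (4 * real r) ^ r)) ^ n * (real n / Q) ^ (r * n)"
    unfolding power_mult[of _ _ n] power_mult_distrib by (simp only: mult_ac)
  finally show ?thesis .
qed

theorem theorem1p15:
  fixes r :: nat
  assumes "r \<ge> 2"
  shows "\<exists>C::real. \<forall>P. r_pattern r P \<and> r_partite r 2 P \<longrightarrow>
    (\<forall>\<^sub>F n in sequentially. \<forall>m::nat. 2 \<le> m \<and> real m \<le> real n powr (1 / real r) \<longrightarrow>
      (let g = (real m - 1) powr ((real r / (real r - 1)) * real n) *
               real n powr ((real r - 1 - 1 / (real r - 1)) * real n)
       in exp (- C * real n) * g \<le> real (num_matchings r P m n) \<and>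
          real (num_matchings r P m n) \<le> exp (C * real n) * g))"
proof -
  define D where "D = cell_density r"
  define A where "A = (2 * exp 1 * real r) ^ r"
  define B where "B = 2 ^ (1 + 2 ^ r * D) * (exp 1 * real D * (4 * real r) ^ r)"
  have e1: "1 \<le> exp (1::real)" by simp
  have "1 \<le> 2 * exp 1 * real r"
    using mult_mono[OF e1, of 1 "2 * real r"] assms by (simp add: mult_ac)
  then have A: "1 \<le> A" unfolding A_def by (rule one_le_power)
  have "1 \<le> D" unfolding D_def cell_density_def using assms by (intro trans_le_add2) simp
  then have "1 \<le> real D" by simp
  then have "1 \<le> exp 1 * real D" using mult_mono[OF e1, of 1 "real D"] by simp
  moreover have "1 \<le> (4 * real r) ^ r" using assms by (intro one_le_power) simp
  ultimately have "1 \<le> exp 1 * real D * (4 * real r) ^ r"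
    using mult_mono[of 1 "exp 1 * real D" 1 "(4 * real r) ^ r"] by simp
  moreover have "1 \<le> (2::real) ^ (1 + 2 ^ r * D)" by (rule one_le_power) simp
  ultimately have B: "1 \<le> B"
    unfolding B_def using mult_mono[of 1 "(2::real) ^ (1 + 2 ^ r * D)" 1 "exp 1 * real D * (4 * real r) ^ r"]
    by simp
  define C where "C = max (ln A) (ln B)"
  have expA: "A ^ n \<le> exp (C * real n)" and expB: "B ^ n \<le> exp (C * real n)" for n
  proof -
    have "A ^ n = exp (ln A * real n)" "B ^ n = exp (ln B * real n)"
      using A B by (simp_all add: exp_of_nat2_mult)
    moreover have "ln A * real n \<le> C * real n" "ln B * real n \<le> C * real n"
      unfolding C_def by (intro mult_right_mono; simp)+
    ultimately show "A ^ n \<le> exp (C * real n)" "B ^ n \<le> exp (C * real n)" by simp_all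
  qed
  show ?thesis
  proof (intro exI[of _ C] allI impI)
    fix P assume P: "r_pattern r P \<and> r_partite r 2 P"
    obtain s where s: "\<And>i. s i = 1 \<or> s i = (-1::int)" and Ps: "P = sign_pattern s r"
      using P by (meson partite_pattern_signs)
    have bounds: "let g = (real m - 1) powr ((real r / (real r - 1)) * real n) *
               real n powr ((real r - 1 - 1 / (real r - 1)) * real n)
       in exp (- C * real n) * g \<le> real (num_matchings r P m n) \<and>
          real (num_matchings r P m n) \<le> exp (C * real n) * g"
      if n: "1 \<le> n" and m: "2 \<le> m" "real m \<le> real n powr (1 / real r)" for n m
    proof -
      define k where "k = m - 1"
      have k: "1 \<le> k" "m = Suc k" "real m - 1 = real k" using m(1) unfolding k_def by auto
      have "real (m ^ r) \<le> (real n powr (1 / real r)) ^ r" using m(2) by (simp add: power_mono)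
      also have "\<dots> = (real n powr (1 / real r)) powr real r" using n by (simp add: powr_realpow)
      also have "\<dots> = real n" using n assms by (simp add: powr_powr)
      finally have "m ^ r \<le> n" by (simp only: of_nat_le_iff)
      moreover have "k ^ r \<le> m ^ r" unfolding k_def by (intro power_mono) auto
      ultimately have kn: "k ^ r \<le> n" by simp
      define Q where "Q = (real n / real k) powr (1 / (real r - 1))"
      define g where "g = (real n / Q) ^ (r * n)"
      have g: "g = (real m - 1) powr ((real r / (real r - 1)) * real n) *
               real n powr ((real r - 1 - 1 / (real r - 1)) * real n)"
        unfolding g_def k(3) using growth_rate_eq[OF assms n k(1) Q_def] by simp
      have g0: "0 \<le> g" unfolding g by simp
      let ?N = "num_matchings r P m n"
      have "g \<le> A ^ n * real ?N"
        unfolding g_def A_def Ps k(2)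
        by (rule lower_estimate[OF assms n k(1) kn Q_def])
          (rule num_matchings_lower[OF assms s k(1)])
      also have "\<dots> \<le> exp (C * real n) * real ?N" by (intro mult_right_mono expA) simp
      finally have "exp (- C * real n) * g \<le> exp (- C * real n) * (exp (C * real n) * real ?N)"
        by (intro mult_left_mono) simp_all
      also have "\<dots> = real ?N" by (simp add: exp_minus)
      finally have lower: "exp (- C * real n) * g \<le> real ?N" .
      have "real ?N \<le> B ^ n * g"
        unfolding g_def B_def Ps k(2)
        by (rule upper_estimate[OF assms n k(1) kn Q_def])
          (simp only: D_def, rule num_matchings_upper[OF assms s k(1) n])
      also have "\<dots> \<le> exp (C * real n) * g" using g0 by (intro mult_right_mono expB)
      finally show ?thesis using lower unfolding g Let_def by simp
    qed
    show "\<forall>\<^sub>F n in sequentially. \<forall>m::nat. 2 \<le> m \<and> real m \<le> real n powr (1 / real r) \<longrightarrow>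
      (let g = (real m - 1) powr ((real r / (real r - 1)) * real n) *
               real n powr ((real r - 1 - 1 / (real r - 1)) * real n)
       in exp (- C * real n) * g \<le> real (num_matchings r P m n) \<and>
          real (num_matchings r P m n) \<le> exp (C * real n) * g)"
      using eventually_ge_at_top[of "1::nat"] by eventually_elim (use bounds in blast)
  qed
qed

end
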